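(* Let $1<p<\infty$, let $\nu\in A_p(0,2\pi)$ satisfy $\nu(x)=\nu(2\pi-x)$ for a.e. $x\in(0,2\pi)$, and let $f\in W^{1,p}_\nu(0,2\pi)$ be such that $f(0)=f(2\pi)=0$. Let $u$ be a weak solution of $$\begin{cases}\displaystyle\iint_\Pi\nabla u\cdot\nabla\varphi\,dx\,dy=0 & \forall\,\varphi\in C^\infty_{J_0}(\overline{\Pi}),\\ u(0,y)=u(2\pi,y) & y\in(0,\infty),\\ u(x,0)=f(x) & x\in(0,2\pi),\end{cases}$$ and suppose that $u\in W^{2,p}_\nu(\Pi)$. Then $u$ is a strong solution of $$\begin{cases}\Delta u(x,y)=0 & \text{for a.e. }(x,y)\in\Pi,\\ u|_{J_0}(y)=u|_{J_{2\pi}}(y) & \text{for a.e. }y\in(0,\infty),\\ u(x,0)=f(x) & \text{for a.e. }x\in(0,2\pi),\\ u_x(0,y)=0 & \text{for a.e. }y\in(0,\infty).\end{cases}$$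
   Context: $\Pi=(0,2\pi)\times(0,\infty)$, with boundary pieces $J=\{(x,0):x\in(0,2\pi)\}$, $J_0=\{(0,y):y\in(0,\infty)\}$, $J_{2\pi}=\{(2\pi,y):y\in(0,\infty)\}$. Test functions: $C^\infty_{J_0}(\overline\Pi)$ is the set of all $\varphi\in C^\infty(\overline\Pi)$ such that $\varphi|_{J\cup J_{2\pi}}=0$ and there exists $\xi_\varphi>0$ with $\varphi(x,y)=0$ for all $(x,y)\in[0,2\pi]\times[\xi_\varphi,\infty)$. Weights: $A_p(0,2\pi)$ is the Muckenhoupt class of $2\pi$-periodic weights $\nu$ (measurable, with values in $[0,\infty]$, with $\nu\in L^1(0,2\pi)$ and $|\nu^{-1}(\{0;\infty\})|=0$) satisfying $$\sup_{I\subset\mathbb{R}}\Big(\frac1{|I|}\int_I\nu\,dx\Big)\Big(\frac1{|I|}\int_I\nu^{-\frac1{p-1}}\,dx\Big)^{p-1}<\infty,$$ the supremum being over all bounded intervals $I\subset\mathbb{R}$. Spaces: $\|f\|_{L^p_\nu(0,2\pi)}=\big(\int_0^{2\pi}|f|^p\nu\,dx\big)^{1/p}$ and $\|f\|_{W^{m,p}_\nu(0,2\pi)}=\sum_{k=0}^m\|f^{(k)}\|_{L^p_\nu(0,2\pi)}$. On the strip (the weight depends only on $x$), $$\|u\|_{L^p_\nu(\Pi)}=\int_0^\infty\Big(\int_0^{2\pi}|u(x,y)|^p\nu(x)\,dx\Big)^{1/p}dy,$$ and $W^{m,p}_\nu(\Pi)$ is the set of measurable functions on $\Pi$ whose distributional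 derivatives up to order $m$ lie in $L^p_\nu(\Pi)$, with norm $\|u\|_{W^{m,p}_\nu(\Pi)}=\sum_{0\le|\alpha|\le m}\|D^\alpha u\|_{L^p_\nu(\Pi)}$. Weak solution: a function $u\in W^{1,p}_\nu(\Pi)$ satisfying the integral identity of the first displayed problem for every $\varphi\in C^\infty_{J_0}(\overline\Pi)$ and the two boundary conditions of that problem. Strong solution: a function $u\in W^{2,p}_\nu(\Pi)$ satisfying the differential equation and all boundary conditions of the second displayed problem a.e. Boundary values of $u$ and $u_x$ are understood in the sense of traces (functions in $W^{1,p}_\nu(\Pi)$ belong to $W^{1,1}(\Pi_\xi)$ on every rectangle $\Pi_\xi=(0,2\pi)\times(0,\xi)$, so traces exist). *)

theory Defs
  imports "HOL-Analysis.Analysis"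
begin

section \<open>Smooth functions and distributional derivatives\<close>

definition partial :: "'a::euclidean_space \<Rightarrow> ('a \<Rightarrow> real) \<Rightarrow> 'a \<Rightarrow> real" where
  "partial b f z = deriv (\<lambda>t. f (z + t *\<^sub>R b)) 0"

text \<open>
  A multi-index \<open>\<alpha>\<close> is encoded as a word of coordinate directions: \<open>D\<^sup>\<alpha> f\<close> is
  \<open>fold partial bs f\<close>, where each basis vector \<open>b\<close> occurs \<open>\<alpha>\<^sub>b\<close> times in \<open>bs\<close>, and
  \<open>|\<alpha>| = length bs\<close>. On smooth functions the order within \<open>bs\<close> is irrelevant.
\<close>

definition words :: "nat \<Rightarrow> 'a::euclidean_space list set" where
  "words m = {bs. set bs \<subseteq> Basis \<and> length bs \<le> m}"

definition smooth :: "('a::euclidean_space \<Rightarrow> real) \<Rightarrow> bool" where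
  "smooth f \<longleftrightarrow> (\<forall>m. \<forall>bs\<in>words m. fold partial bs f differentiable_on UNIV)"

definition test_fun :: "'a::euclidean_space set \<Rightarrow> ('a \<Rightarrow> real) \<Rightarrow> bool" where
  "test_fun \<Omega> \<phi> \<longleftrightarrow> smooth \<phi> \<and> compact (closure {z. \<phi> z \<noteq> 0}) \<and> closure {z. \<phi> z \<noteq> 0} \<subseteq> \<Omega>"

definition locally_integrable :: "'a::euclidean_space set \<Rightarrow> ('a \<Rightarrow> real) \<Rightarrow> bool" where
  "locally_integrable \<Omega> u \<longleftrightarrow> (\<forall>K. compact K \<and> K \<subseteq> \<Omega> \<longrightarrow> u absolutely_integrable_on K)"

definition has_weak_deriv ::
  "'a::euclidean_space set \<Rightarrow> 'a list \<Rightarrow> ('a \<Rightarrow> real) \<Rightarrow> ('a \<Rightarrow> real) \<Rightarrow> bool" where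
  "has_weak_deriv \<Omega> bs u g \<longleftrightarrow> locally_integrable \<Omega> u \<and> locally_integrable \<Omega> g \<and>
     (\<forall>\<phi>. test_fun \<Omega> \<phi> \<longrightarrow>
        (LINT z:\<Omega>|lebesgue. u z * fold partial bs \<phi> z)
          = (-1) ^ length bs * (LINT z:\<Omega>|lebesgue. g z * \<phi> z))"

text \<open>Determined up to equality a.e. in \<open>\<Omega>\<close> whenever a weak derivative exists.\<close>

definition weak_deriv ::
  "'a::euclidean_space set \<Rightarrow> 'a list \<Rightarrow> ('a \<Rightarrow> real) \<Rightarrow> 'a \<Rightarrow> real" where
  "weak_deriv \<Omega> bs u = (SOME g. has_weak_deriv \<Omega> bs u g)"

text \<open>
  The Sobolev space of order \<open>m\<close> over the function space with extended norm \<open>N\<close>.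
  The empty word has \<open>u\<close> itself (up to a null set) as its derivative, and local
  integrability entails measurability on the open set \<open>\<Omega>\<close>.
\<close>

definition sobolev ::
  "'a::euclidean_space set \<Rightarrow> nat \<Rightarrow> (('a \<Rightarrow> real) \<Rightarrow> ennreal) \<Rightarrow> ('a \<Rightarrow> real) set" where
  "sobolev \<Omega> m N = {u. \<forall>bs\<in>words m. \<exists>g. has_weak_deriv \<Omega> bs u g \<and> N g < top}"


section \<open>Traces\<close>

text \<open>
  \<open>g\<close> is the trace of \<open>u \<in> W\<^sup>1\<^sup>,\<^sup>1(\<Omega>)\<close> on the boundary piece \<open>\<gamma> ` S\<close>, with \<open>\<gamma>\<close> an
  arc-length parametrisation: functions smooth up to the boundary converge to \<open>u\<close> in
  \<open>W\<^sup>1\<^sup>,\<^sup>1(\<Omega>)\<close> and their restrictions to the boundary piece converge to \<open>g\<close> in \<open>L\<^sup>1\<close>.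
  Here \<open>C\<^sup>\<infinity>\<close> of the closure of \<open>\<Omega>\<close> means restrictions of smooth functions on the whole space.
\<close>

definition has_trace ::
  "'a::euclidean_space set \<Rightarrow> (real \<Rightarrow> 'a) \<Rightarrow> real set \<Rightarrow> ('a \<Rightarrow> real) \<Rightarrow> (real \<Rightarrow> real) \<Rightarrow> bool" where
  "has_trace \<Omega> \<gamma> S u g \<longleftrightarrow> g \<in> borel_measurable (lebesgue_on S) \<and>
     (\<exists>D. (\<forall>b\<in>Basis. has_weak_deriv \<Omega> [b] u (D b)) \<and>
       (\<exists>U :: nat \<Rightarrow> 'a \<Rightarrow> real.
          (\<forall>n. smooth (U n)) \<and>
          (\<lambda>n. \<integral>\<^sup>+z\<in>\<Omega>. ennreal \<bar>U n z - u z\<bar> \<partial>lebesgue) \<longlonglongrightarrow> 0 \<and>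
          (\<forall>b\<in>Basis. (\<lambda>n. \<integral>\<^sup>+z\<in>\<Omega>. ennreal \<bar>partial b (U n) z - D b z\<bar> \<partial>lebesgue) \<longlonglongrightarrow> 0) \<and>
          (\<lambda>n. \<integral>\<^sup>+t\<in>S. ennreal \<bar>U n (\<gamma> t) - g t\<bar> \<partial>lebesgue) \<longlonglongrightarrow> 0))"


section \<open>Muckenhoupt weights\<close>

text \<open>Powers on \<open>[0,\<infinity>]\<close>, with \<open>0\<^sup>a = \<infinity>\<close> and \<open>\<infinity>\<^sup>a = 0\<close> for \<open>a < 0\<close>.\<close>

definition epowr :: "ennreal \<Rightarrow> real \<Rightarrow> ennreal" where
  "epowr x a =
     (if a = 0 then 1
      else if x = 0 then (if a < 0 then top else 0)
      else if x = top then (if a < 0 then 0 else top)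
      else ennreal (enn2real x powr a))"

definition average :: "real set \<Rightarrow> (real \<Rightarrow> ennreal) \<Rightarrow> ennreal" where
  "average I h = (\<integral>\<^sup>+x\<in>I. h x \<partial>lebesgue) / emeasure lebesgue I"

text \<open>Degenerate intervals, over which no average is defined, are left out of the supremum.\<close>

definition muckenhoupt :: "real \<Rightarrow> (real \<Rightarrow> ennreal) set" where
  "muckenhoupt p = {\<nu>.
     \<nu> \<in> borel_measurable lebesgue \<and>
     (\<forall>x. \<nu> (x + 2 * pi) = \<nu> x) \<and>
     (\<integral>\<^sup>+x\<in>{0<..<2 * pi}. \<nu> x \<partial>lebesgue) < top \<and>
     emeasure lebesgue (\<nu> -` {0, top}) = 0 \<and>
     (SUP I\<in>{I. is_interval I \<and> bounded I \<and> interior I \<noteq> {}}.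
        average I \<nu> * epowr (average I (\<lambda>x. epowr (\<nu> x) (- 1 / (p - 1)))) (p - 1)) < top}"


section \<open>The half-strip and the weighted spaces\<close>

definition strip :: "(real \<times> real) set" where
  "strip = {0<..<2 * pi} \<times> {0<..}"

definition strip_upto :: "real \<Rightarrow> (real \<times> real) set" where
  "strip_upto \<xi> = {0<..<2 * pi} \<times> {0<..<\<xi>}"

abbreviation e\<^sub>x :: "real \<times> real" where "e\<^sub>x \<equiv> (1, 0)"
abbreviation e\<^sub>y :: "real \<times> real" where "e\<^sub>y \<equiv> (0, 1)"

definition Lp_norm_interval :: "real \<Rightarrow> (real \<Rightarrow> ennreal) \<Rightarrow> (real \<Rightarrow> real) \<Rightarrow> ennreal" where
  "Lp_norm_interval p \<nu> f =
     epowr (\<integral>\<^sup>+x\<in>{0<..<2 * pi}. ennreal (\<bar>f x\<bar> powr p) * \<nu> x \<partial>lebesgue) (1 / p)"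

definition Lp_norm_strip :: "real \<Rightarrow> (real \<Rightarrow> ennreal) \<Rightarrow> (real \<times> real \<Rightarrow> real) \<Rightarrow> ennreal" where
  "Lp_norm_strip p \<nu> u = (\<integral>\<^sup>+y\<in>{0<..}. Lp_norm_interval p \<nu> (\<lambda>x. u (x, y)) \<partial>lebesgue)"

definition W_interval :: "nat \<Rightarrow> real \<Rightarrow> (real \<Rightarrow> ennreal) \<Rightarrow> (real \<Rightarrow> real) set" where
  "W_interval m p \<nu> = sobolev {0<..<2 * pi} m (Lp_norm_interval p \<nu>)"

definition W_strip :: "nat \<Rightarrow> real \<Rightarrow> (real \<Rightarrow> ennreal) \<Rightarrow> (real \<times> real \<Rightarrow> real) set" where
  "W_strip m p \<nu> = sobolev strip m (Lp_norm_strip p \<nu>)"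

text \<open>
  Point values of a Sobolev function on the interval are those of its continuous
  representative on \<open>[0,2\<pi>]\<close>.
\<close>

definition vanishes_at_endpoints :: "(real \<Rightarrow> real) \<Rightarrow> bool" where
  "vanishes_at_endpoints f \<longleftrightarrow>
     (\<exists>F. continuous_on {0..2 * pi} F \<and> (AE x in lebesgue_on {0<..<2 * pi}. f x = F x) \<and>
          F 0 = 0 \<and> F (2 * pi) = 0)"

text \<open>Traces on the vertical side \<open>{a} \<times> (0,\<infinity>)\<close> and on the base \<open>(0,2\<pi>) \<times> {0}\<close>.\<close>

definition has_side_trace :: "real \<Rightarrow> (real \<times> real \<Rightarrow> real) \<Rightarrow> (real \<Rightarrow> real) \<Rightarrow> bool" where
  "has_side_trace a u g \<longleftrightarrow>
     (\<forall>\<xi>>0. has_trace (strip_upto \<xi>) (\<lambda>y. (a, y)) {0<..<\<xi>} u g)"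

definition has_base_trace :: "(real \<times> real \<Rightarrow> real) \<Rightarrow> (real \<Rightarrow> real) \<Rightarrow> bool" where
  "has_base_trace u g \<longleftrightarrow>
     (\<forall>\<xi>>0. has_trace (strip_upto \<xi>) (\<lambda>x. (x, 0)) {0<..<2 * pi} u g)"


section \<open>Weak and strong solutions\<close>

definition strip_test_fun :: "(real \<times> real \<Rightarrow> real) \<Rightarrow> bool" where
  "strip_test_fun \<phi> \<longleftrightarrow> smooth \<phi> \<and>
     (\<forall>x\<in>{0<..<2 * pi}. \<phi> (x, 0) = 0) \<and>
     (\<forall>y>0. \<phi> (2 * pi, y) = 0) \<and>
     (\<exists>\<xi>>0. \<forall>x\<in>{0..2 * pi}. \<forall>y\<ge>\<xi>. \<phi> (x, y) = 0)"

definition weak_solution ::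
  "real \<Rightarrow> (real \<Rightarrow> ennreal) \<Rightarrow> (real \<Rightarrow> real) \<Rightarrow> (real \<times> real \<Rightarrow> real) \<Rightarrow> bool" where
  "weak_solution p \<nu> f u \<longleftrightarrow>
     u \<in> W_strip 1 p \<nu> \<and>
     (\<forall>\<phi>. strip_test_fun \<phi> \<longrightarrow>
        (LINT z:strip|lebesgue.
           weak_deriv strip [e\<^sub>x] u z * partial e\<^sub>x \<phi> z
           + weak_deriv strip [e\<^sub>y] u z * partial e\<^sub>y \<phi> z) = 0) \<and>
     (\<exists>g\<^sub>0 g\<^sub>1. has_side_trace 0 u g\<^sub>0 \<and> has_side_trace (2 * pi) u g\<^sub>1 \<and>
        (AE y in lebesgue_on {0<..}. g\<^sub>0 y = g\<^sub>1 y)) \<and>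
     (\<exists>g. has_base_trace u g \<and> (AE x in lebesgue_on {0<..<2 * pi}. g x = f x))"

definition strong_solution ::
  "real \<Rightarrow> (real \<Rightarrow> ennreal) \<Rightarrow> (real \<Rightarrow> real) \<Rightarrow> (real \<times> real \<Rightarrow> real) \<Rightarrow> bool" where
  "strong_solution p \<nu> f u \<longleftrightarrow>
     u \<in> W_strip 2 p \<nu> \<and>
     (AE z in lebesgue_on strip.
        weak_deriv strip [e\<^sub>x, e\<^sub>x] u z + weak_deriv strip [e\<^sub>y, e\<^sub>y] u z = 0) \<and>
     (\<exists>g\<^sub>0 g\<^sub>1. has_side_trace 0 u g\<^sub>0 \<and> has_side_trace (2 * pi) u g\<^sub>1 \<and>
        (AE y in lebesgue_on {0<..}. g\<^sub>0 y = g\<^sub>1 y)) \<and>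
     (\<exists>g. has_base_trace u g \<and> (AE x in lebesgue_on {0<..<2 * pi}. g x = f x)) \<and>
     (\<exists>g. has_side_trace 0 (weak_deriv strip [e\<^sub>x] u) g \<and>
        (AE y in lebesgue_on {0<..}. g y = 0))"

end

theory Submission
  imports Defs
begin

text \<open>
  Testing the weak formulation with functions supported inside the strip gives
  \<open>u\<^sub>x\<^sub>x + u\<^sub>y\<^sub>y = 0\<close> a.e. Testing it with functions that do not vanish on the side \<open>x = 0\<close>
  shows that the extension of \<open>u\<^sub>x\<close> by zero to \<open>x \<le> 0\<close> has as weak derivatives the zero extensions
  of \<open>u\<^sub>x\<^sub>x\<close> and \<open>u\<^sub>x\<^sub>y\<close>. Convolve this extension with mollifiers supported in \<open>x > 0\<close>, \<open>y < 0\<close>: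
  the results are smooth on the plane, vanish identically on \<open>x = 0\<close>, and converge to \<open>u\<^sub>x\<close> in
  \<open>W\<^sup>1\<^sup>,\<^sup>1\<close> of the strip, so \<open>u\<^sub>x\<close> has zero trace there. The Muckenhoupt condition enters only through
  the integrability of \<open>\<nu>\<^bsup>-1/(p-1)\<^esup>\<close>, which embeds the weighted space into \<open>L\<^sup>1\<close>.
\<close>

section \<open>Smooth functions\<close>

text \<open>Zero normal derivative on \<open>x = 0\<close> is the natural boundary condition of the
  weak formulation: this side is the only one where test functions are free. On the base and on
  \<open>x = 2 * pi\<close> they vanish, so a zero extension across those pieces may well jump, and
  a symmetric kernel would pick up such jumps. This dictates the direction of the mollifiers. The
  shifted kernel belonging to any point of the strip stays off the base and the right side, however
  close the point is to them, and is therefore itself an admissible test function. This kernel is a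
  product \<open>a(x) b(y)\<close>, so for the side condition smoothness in one variable suffices.
  The product form matters a second time: a cutoff near \<open>x = 0\<close> commutes with
  \<open>y\<close>-derivatives but not with \<open>x\<close>-derivatives. The information on
  \<open>u_x\<close> comes instead from moving the \<open>y\<close>-derivative off \<open>b\<close>
  and then exchanging \<open>u_yy\<close> for \<open>- u_xx\<close>.\<close>

primrec times_differentiable :: "nat \<Rightarrow> (real \<Rightarrow> real) \<Rightarrow> bool" where
  "times_differentiable 0 f \<longleftrightarrow> True"
| "times_differentiable (Suc n) f \<longleftrightarrow>
     (\<exists>f'. (\<forall>x. (f has_real_derivative f' x) (at x)) \<and> times_differentiable n f')"

definition smooth_real :: "(real \<Rightarrow> real) \<Rightarrow> bool" where
  "smooth_real f \<longleftrightarrow> (\<forall>n. times_differentiable n f)"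

lemma times_differentiable_Suc_imp:
  "times_differentiable (Suc n) f \<Longrightarrow> times_differentiable n f"
proof (induction n arbitrary: f)
  case (Suc n)
  then show ?case by (metis times_differentiable.simps(2))
qed simp

lemma times_differentiable_add:
  "times_differentiable n f \<Longrightarrow> times_differentiable n g \<Longrightarrow> times_differentiable n (\<lambda>x. f x + g x)"
proof (induction n arbitrary: f g)
  case (Suc n)
  then obtain f' g' where "\<forall>x. (f has_real_derivative f' x) (at x)" "times_differentiable n f'"
    "\<forall>x. (g has_real_derivative g' x) (at x)" "times_differentiable n g'" by auto
  then show ?case using Suc.IH[of f' g']
    by (auto intro!: exI[of _ "\<lambda>x. f' x + g' x"] derivative_intros)
qed simp

text \<open>The product rule brings back \<open>f\<close> and \<open>g\<close> themselves next to
  their derivatives. The induction therefore also needs order \<open>n\<close> for the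
  undifferentiated factors, which comes from lowering the order by one.\<close>

lemma times_differentiable_mult:
  "times_differentiable n f \<Longrightarrow> times_differentiable n g \<Longrightarrow> times_differentiable n (\<lambda>x. f x * g x)"
proof (induction n arbitrary: f g)
  case (Suc n)
  then obtain f' g' where d: "\<forall>x. (f has_real_derivative f' x) (at x)" "times_differentiable n f'"
    "\<forall>x. (g has_real_derivative g' x) (at x)" "times_differentiable n g'" by auto
  have "times_differentiable n f" "times_differentiable n g"
    using Suc.prems times_differentiable_Suc_imp by blast+
  then have "times_differentiable n (\<lambda>x. f' x * g x + f x * g' x)"
    using Suc.IH d by (intro times_differentiable_add) auto
  moreover have "((\<lambda>x. f x * g x) has_real_derivative f' x * g x + f x * g' x) (at x)" for x
    using d by (auto intro!: derivative_eq_intros)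
  ultimately show ?case
    unfolding times_differentiable.simps by (intro exI[of _ "\<lambda>x. f' x * g x + f x * g' x"] conjI allI)
qed simp

lemma times_differentiable_const: "times_differentiable n (\<lambda>x. c)"
  by (induction n arbitrary: c) (auto intro!: exI[of _ "\<lambda>x. 0"])

lemma times_differentiable_affine:
  "times_differentiable n f \<Longrightarrow> times_differentiable n (\<lambda>x. f (c * x + d))"
proof (induction n arbitrary: f)
  case (Suc n)
  then obtain f' where d: "\<forall>x. (f has_real_derivative f' x) (at x)" "times_differentiable n f'"
    by auto
  have "((\<lambda>x. f (c * x + d)) has_real_derivative f' (c * x + d) * c) (at x)" for x
    using d(1) by (intro DERIV_chain2[where f = f]) (auto intro!: derivative_eq_intros)
  moreover have "times_differentiable n (\<lambda>x. f' (c * x + d) * c)"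
    using Suc.IH[OF d(2)] by (intro times_differentiable_mult times_differentiable_const)
  ultimately show ?case
    unfolding times_differentiable.simps by (intro exI[of _ "\<lambda>x. f' (c * x + d) * c"] conjI allI)
qed simp

lemma smooth_real_mult: "smooth_real f \<Longrightarrow> smooth_real g \<Longrightarrow> smooth_real (\<lambda>x. f x * g x)"
  and smooth_real_const: "smooth_real (\<lambda>x. c)"
  and smooth_real_affine: "smooth_real f \<Longrightarrow> smooth_real (\<lambda>x. f (c * x + d))"
  by (auto simp: smooth_real_def times_differentiable_mult times_differentiable_const
      times_differentiable_affine)

text \<open>Every order \<open>n\<close> supplies its own witness for the derivative. Uniqueness of
  derivatives identifies all of them with \<open>deriv f\<close>, so one function is differentiable
  to every order.\<close>

lemma smooth_real_DERIV: "(f has_real_derivative deriv f x) (at x)"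
  and smooth_real_deriv: "smooth_real (deriv f)" if f: "smooth_real f"
proof -
  have "\<exists>f'. (\<forall>x. (f has_real_derivative f' x) (at x)) \<and> times_differentiable n f'" for n
    using f unfolding smooth_real_def by (metis times_differentiable.simps(2))
  moreover have "f' = deriv f" if "\<forall>x. (f has_real_derivative f' x) (at x)" for f'
    by (rule ext, rule DERIV_imp_deriv[symmetric], rule that[rule_format])
  ultimately have "\<forall>n. (\<forall>x. (f has_real_derivative deriv f x) (at x)) \<and> times_differentiable n (deriv f)"
    by metis
  then show "(f has_real_derivative deriv f x) (at x)" "smooth_real (deriv f)"
    by (auto simp: smooth_real_def)
qed

lemma smooth_real_continuous_on: "smooth_real f \<Longrightarrow> continuous_on S f"
  using smooth_real_DERIV DERIV_isCont continuous_at_imp_continuous_on by blast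

lemma smooth_real_measurable [measurable_dest]: "smooth_real f \<Longrightarrow> f \<in> borel_measurable borel"
  by (intro borel_measurable_continuous_onI smooth_real_continuous_on)

section \<open>Functions of the type exp(-1/x), cutoffs and one-sided mollifiers on the line\<close>

definition flat :: "real poly \<Rightarrow> real \<Rightarrow> real" where
  "flat P x = (if x > 0 then poly P (1 / x) * exp (- (1 / x)) else 0)"

lemma tendsto_poly_mult_exp_neg: "((\<lambda>t. poly P t * exp (- t)) \<longlongrightarrow> (0::real)) at_top"
proof -
  have "((\<lambda>t. \<Sum>i\<le>degree P. coeff P i * (t ^ i / exp t)) \<longlongrightarrow> (\<Sum>i\<le>degree P. coeff P i * 0)) at_top"
    by (intro tendsto_intros tendsto_power_div_exp_0)
  then show ?thesis
    by (simp add: poly_altdef exp_minus field_simps sum_distrib_left)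
qed

text \<open>With t = 1/x, the derivative of P(t) exp(-t) is t^2 (P(t) - P'(t)) exp(-t). The
  polynomial is carried along because it closes the family under differentiation, and smoothness of
  all members then follows by a single induction.\<close>

lemma flat_DERIV: "(flat P has_real_derivative flat (monom 1 2 * (P - pderiv P)) x) (at x)"
proof -
  consider "x > 0" | "x < 0" | "x = 0" by linarith
  then show ?thesis
  proof cases
    case 1
    have "((\<lambda>x. poly P (1 / x) * exp (- (1 / x))) has_real_derivative
            flat (monom 1 2 * (P - pderiv P)) x) (at x)"
      using 1 by (auto intro!: derivative_eq_intros DERIV_chain2[OF poly_DERIV]
          simp: flat_def poly_monom field_simps power2_eq_square)
    then show ?thesis
      by (rule DERIV_cong_ev[THEN iffD1, rotated -1, OF _ refl _ refl])
        (use 1 in \<open>auto intro!: eventually_mono[OF order_tendstoD(1)[OF tendsto_ident_at]] simp: flat_def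
          eventually_nhds intro!: exI[of _ "{0<..}"]\<close>)
  next
    case 2
    have "((\<lambda>x. 0) has_real_derivative flat (monom 1 2 * (P - pderiv P)) x) (at x)"
      using 2 by (auto simp: flat_def)
    then show ?thesis
      by (rule DERIV_cong_ev[THEN iffD1, rotated -1, OF _ refl _ refl])
        (use 2 in \<open>auto simp: flat_def eventually_nhds intro!: exI[of _ "{..<0}"]\<close>)
  next
    case 3
    have "((\<lambda>h. flat P h / h) \<longlongrightarrow> 0) (at_left 0)"
      by (rule tendsto_eventually) (auto simp: flat_def eventually_at_filter)
    \<comment> \<open>Dividing by \<open>h\<close> multiplies the polynomial in \<open>1 / h\<close>
      by one more variable, so the difference quotient at 0 is again a polynomial times a decaying
      exponential.\<close>
    moreover have "((\<lambda>h. poly (monom 1 1 * P) (inverse h) * exp (- inverse h)) \<longlongrightarrow> 0) (at_right 0)"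
      by (rule filterlim_compose[OF tendsto_poly_mult_exp_neg filterlim_inverse_at_top_right])
    then have "((\<lambda>h. flat P h / h) \<longlongrightarrow> 0) (at_right 0)"
      by (rule filterlim_cong[THEN iffD1, rotated -1, OF _ refl refl])
        (auto simp: flat_def poly_monom eventually_at_filter field_simps)
    ultimately have "((\<lambda>h. flat P h / h) \<longlongrightarrow> 0) (at 0)"
      by (simp add: filterlim_at_split)
    then show ?thesis using 3 by (simp add: has_field_derivative_iff flat_def)
  qed
qed

lemma smooth_real_flat: "smooth_real (flat P)"
proof -
  have "times_differentiable n (flat P)" for n
  proof (induction n arbitrary: P)
    case (Suc n)
    then show ?case using flat_DERIV[of P] by (auto intro!: exI[of _ "flat (monom 1 2 * (P - pderiv P))"])
  qed simp
  then show ?thesis by (simp add: smooth_real_def)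
qed

text \<open>The values stay below 1 and only tend to 1 as \<open>k\<close> grows. Pointwise
  convergence with a uniform bound is all that dominated convergence asks for, so no plateau is
  built in.\<close>

definition cutoff :: "nat \<Rightarrow> real \<Rightarrow> real" where
  "cutoff k t = flat 1 (real k * t - 1)"

lemma smooth_real_cutoff: "smooth_real (cutoff k)"
  using smooth_real_affine[OF smooth_real_flat, of 1 "real k" "-1"] by (simp add: cutoff_def[abs_def])

lemma cutoff_bounds: "0 \<le> cutoff k t" "cutoff k t \<le> 1"
  by (auto simp: cutoff_def flat_def)

lemma cutoff_eq_0: "t \<le> 1 / real k \<Longrightarrow> cutoff k t = 0"
  by (cases "k = 0") (auto simp: cutoff_def flat_def field_simps)

lemma cutoff_tendsto_1:
  assumes "t > 0"
  shows "(\<lambda>k. cutoff k t) \<longlonglongrightarrow> 1"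
proof -
  have lim: "filterlim (\<lambda>k. real k * t - 1) at_top sequentially"
    using filterlim_tendsto_add_at_top[OF tendsto_const[of "-1"]
        filterlim_at_top_mult_tendsto_pos[OF tendsto_const assms filterlim_real_sequentially]]
    by (simp add: add.commute)
  have "((\<lambda>s. exp (- (1 / s))) \<longlongrightarrow> exp (- (0::real))) at_top"
    by (intro tendsto_intros tendsto_divide_0[OF tendsto_const] filterlim_at_top_imp_at_infinity filterlim_ident)
  then have "((\<lambda>s. exp (- (1 / s))) \<longlongrightarrow> (1::real)) at_top"
    by simp
  from filterlim_compose[OF this lim]
  show ?thesis
    by (rule filterlim_cong[THEN iffD1, rotated -1, OF _ refl refl])
      (use filterlim_at_top_dense[THEN iffD1, OF lim, rule_format, of 0] in
        \<open>auto elim!: eventually_mono simp: cutoff_def flat_def\<close>)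
qed

text \<open>Two copies of exp(-1/x) face each other, one vanishing left of \<epsilon>/2 and the
  other right of \<epsilon>. Their product is at most 1 on a bounded support and positive in
  between, so its integral is finite and nonzero and can be divided out. The support lies strictly
  on one side of 0, as the directed kernels require.\<close>

lemma exists_mollifier:
  assumes "0 < \<epsilon>"
  obtains \<eta> :: "real \<Rightarrow> real" where "smooth_real \<eta>" "\<And>t. 0 \<le> \<eta> t"
    "\<And>t. t \<notin> {\<epsilon>/2..\<epsilon>} \<Longrightarrow> \<eta> t = 0" "(\<integral>\<^sup>+t. ennreal (\<eta> t) \<partial>lborel) = 1"
proof -
  define g where "g t = flat 1 (1 * t + (- \<epsilon> / 2)) * flat 1 ((-1) * t + \<epsilon>)" for t
  have sg: "smooth_real g"
    unfolding g_def by (intro smooth_real_mult smooth_real_affine smooth_real_flat)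
  have [measurable]: "g \<in> borel_measurable borel"
    using sg by (rule smooth_real_measurable)
  have g0: "0 \<le> g t" and g1: "g t \<le> 1" for t
    by (auto simp: g_def flat_def intro!: mult_le_one)
  have gsupp: "g t = 0" if "t \<notin> {\<epsilon>/2..\<epsilon>}" for t
    using that by (auto simp: g_def flat_def)
  have gpos: "g t > 0" if "t \<in> {\<epsilon>/2<..<\<epsilon>}" for t
    using that by (auto simp: g_def flat_def)
  define c where "c = (\<integral>\<^sup>+t. ennreal (g t) \<partial>lborel)"
  have "c \<le> (\<integral>\<^sup>+t. indicator {\<epsilon>/2..\<epsilon>} t \<partial>lborel)"
    unfolding c_def by (intro nn_integral_mono) (use g1 gsupp in \<open>auto simp: indicator_def ennreal_le_1\<close>)
  also have "\<dots> < \<infinity>" by (simp add: emeasure_lborel_Icc_eq)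
  finally have c_fin: "c < top" by simp
  have "c \<noteq> 0"
  proof
    assume "c = 0"
    then have "AE t in lborel. g t = 0"
      unfolding c_def by (subst (asm) nn_integral_0_iff_AE) (auto simp: ennreal_eq_0_iff elim!: eventually_mono intro!: antisym g0)
    then have "AE t in lborel. t \<notin> {\<epsilon>/2<..<\<epsilon>}"
      by (rule eventually_mono) (use gpos in force)
    then have "emeasure lborel {\<epsilon>/2<..<\<epsilon>} = 0"
      by (subst (asm) AE_iff_measurable[where N = "{\<epsilon>/2<..<\<epsilon>}"]) auto
    then show False using assms by (simp add: emeasure_lborel_Ioo)
  qed
  define C where "C = enn2real c"
  have C: "c = ennreal C" "C > 0"
    using c_fin \<open>c \<noteq> 0\<close> by (auto simp: C_def enn2real_positive_iff less_top zero_less_iff_neq_zero)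
  show ?thesis
  proof
    show "smooth_real (\<lambda>t. 1 / C * g t)"
      by (intro smooth_real_mult smooth_real_const sg)
    show "0 \<le> 1 / C * g t" for t using g0 C by simp
    show "1 / C * g t = 0" if "t \<notin> {\<epsilon>/2..\<epsilon>}" for t using gsupp that by simp
    have "(\<integral>\<^sup>+t. ennreal (1 / C * g t) \<partial>lborel) = ennreal (1 / C) * c"
      unfolding c_def using C g0 by (subst nn_integral_cmult[symmetric]) (auto simp: ennreal_mult'[symmetric])
    also have "\<dots> = 1" using C by (simp add: ennreal_mult'[symmetric] ennreal_1[symmetric] del: ennreal_1)
    finally show "(\<integral>\<^sup>+t. ennreal (1 / C * g t) \<partial>lborel) = 1" .
  qed
qed

section \<open>Products of functions of one variable as smooth functions and test functions on the
  plane\<close>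

definition tensor :: "(real \<Rightarrow> real) \<Rightarrow> (real \<Rightarrow> real) \<Rightarrow> real \<times> real \<Rightarrow> real" where
  "tensor a b z = a (fst z) * b (snd z)"

lemma Basis_plane: "Basis = {(1, 0), (0, 1) :: real \<times> real}"
  by (auto simp: Basis_prod_def)

lemma partial_eqI:
  assumes "(f has_derivative L) (at z)"
  shows "partial b f z = L b"
proof -
  have "(f has_derivative L) (at (z + 0 *\<^sub>R b))" using assms by simp
  then have "((\<lambda>t. f (z + t *\<^sub>R b)) has_derivative (\<lambda>t. L (t *\<^sub>R b))) (at 0)"
    by (intro has_derivative_compose[where f = "\<lambda>t. z + t *\<^sub>R b" and g = f and x = 0])
      (auto intro!: derivative_eq_intros)
  moreover have "(\<lambda>t. L (t *\<^sub>R b)) = (*) (L b)"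
    using has_derivative_linear[OF assms] by (auto simp: linear_scale)
  ultimately have "((\<lambda>t. f (z + t *\<^sub>R b)) has_field_derivative L b) (at 0)"
    by (simp only: has_field_derivative_def)
  then show ?thesis unfolding partial_def by (rule DERIV_imp_deriv)
qed

text \<open>Any class of differentiable functions closed under partial derivatives consists of
  smooth functions. The induction over words is done here once; the classes used later are the
  products and the convolutions of a fixed function with products.\<close>

lemma smooth_coinduct:
  fixes f :: "'a::euclidean_space \<Rightarrow> real"
  assumes "P f"
    and "\<And>g. P g \<Longrightarrow> g differentiable_on UNIV"
    and "\<And>g b. P g \<Longrightarrow> b \<in> Basis \<Longrightarrow> P (partial b g)"
  shows "smooth f"
proof -
  have "P (fold partial bs g)" if "set bs \<subseteq> Basis" "P g" for bs g
    using that by (induction bs arbitrary: g) (auto simp: assms(3))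
  then show ?thesis using assms(1,2) by (auto simp: smooth_def words_def)
qed

lemma tensor_has_derivative:
  assumes "smooth_real a" "smooth_real b"
  shows "(tensor a b has_derivative
    (\<lambda>h. tensor (deriv a) b z * fst h + tensor a (deriv b) z * snd h)) (at z)"
  unfolding tensor_def[abs_def] using smooth_real_DERIV[OF assms(1)] smooth_real_DERIV[OF assms(2)]
  by (auto intro!: derivative_eq_intros
      DERIV_compose_FDERIV[OF smooth_real_DERIV[OF assms(1)]]
      DERIV_compose_FDERIV[OF smooth_real_DERIV[OF assms(2)]] simp: algebra_simps)

lemma partial_tensor:
  assumes "smooth_real a" "smooth_real b"
  shows "partial (1, 0) (tensor a b) = tensor (deriv a) b"
    and "partial (0, 1) (tensor a b) = tensor a (deriv b)"
  using partial_eqI[OF tensor_has_derivative[OF assms]] by auto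

lemma smooth_tensor:
  assumes "smooth_real a" "smooth_real b"
  shows "smooth (tensor a b)"
proof (rule smooth_coinduct[where P = "\<lambda>g. \<exists>a b. smooth_real a \<and> smooth_real b \<and> g = tensor a b"])
  fix g :: "real \<times> real \<Rightarrow> real" assume "\<exists>a b. smooth_real a \<and> smooth_real b \<and> g = tensor a b"
  then obtain a b where g: "smooth_real a" "smooth_real b" "g = tensor a b" by blast
  show "g differentiable_on UNIV"
    using tensor_has_derivative[OF g(1,2)] g(3)
    by (meson differentiableI differentiable_at_imp_differentiable_on)
  show "\<exists>a b. smooth_real a \<and> smooth_real b \<and> partial c g = tensor a b" if "c \<in> Basis" for c
    using that g partial_tensor[OF g(1,2)] smooth_real_deriv by (auto simp: Basis_plane)
qed (use assms in auto)

lemma continuous_on_tensor: "smooth_real a \<Longrightarrow> smooth_real b \<Longrightarrow> continuous_on S (tensor a b)"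
  by (meson tensor_has_derivative has_derivative_continuous continuous_at_imp_continuous_on)

lemma tensor_measurable:
  "smooth_real a \<Longrightarrow> smooth_real b \<Longrightarrow> tensor a b \<in> borel_measurable borel"
  by (intro borel_measurable_continuous_onI continuous_on_tensor)

lemma test_fun_tensor:
  assumes "smooth_real a" "smooth_real b"
    and a: "\<And>t. t \<notin> {x0..x1} \<Longrightarrow> a t = 0" and b: "\<And>t. t \<notin> {y0..y1} \<Longrightarrow> b t = 0"
    and sub: "{x0..x1} \<times> {y0..y1} \<subseteq> \<Omega>"
  shows "test_fun \<Omega> (tensor a b)"
proof -
  have cp: "compact ({x0..x1} \<times> {y0..y1})" by (intro compact_Times compact_Icc)
  have "{z. tensor a b z \<noteq> 0} \<subseteq> {x0..x1} \<times> {y0..y1}"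
    using a b by (force simp: tensor_def)
  then have "closure {z. tensor a b z \<noteq> 0} \<subseteq> {x0..x1} \<times> {y0..y1}"
    using cp by (intro closure_minimal compact_imp_closed)
  then show ?thesis
    using cp sub smooth_tensor[OF assms(1,2)] unfolding test_fun_def
    by (meson closed_closure compact_Int_closed compact_closure bounded_subset compact_imp_bounded order_trans closure_subset)
qed

section \<open>Uniform Taylor bounds for smooth functions of compact support\<close>

definition smooth_cc :: "(real \<Rightarrow> real) \<Rightarrow> bool" where
  "smooth_cc f \<longleftrightarrow> smooth_real f \<and> (\<exists>l u. \<forall>t. t \<notin> {l..u} \<longrightarrow> f t = 0)"

lemma deriv_eq_0_outside:
  fixes f :: "real \<Rightarrow> real"
  assumes "\<And>t. t \<notin> {l..u} \<Longrightarrow> f t = 0" "t \<notin> {l..u}"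
  shows "deriv f t = 0"
proof -
  have "open (- {l..u})" "t \<in> - {l..u}" using assms(2) by auto
  then have "eventually (\<lambda>s. f s = 0) (nhds t)"
    unfolding eventually_nhds using assms(1) by blast
  then have "deriv f t = deriv (\<lambda>_. 0) t"
    by (rule deriv_cong_ev) simp
  then show ?thesis by simp
qed

lemma smooth_cc_deriv: "smooth_cc f \<Longrightarrow> smooth_cc (deriv f)"
  unfolding smooth_cc_def using smooth_real_deriv deriv_eq_0_outside by metis

lemma smooth_cc_bounded:
  assumes "smooth_cc f"
  obtains M where "M \<ge> 0" "\<And>t. \<bar>f t\<bar> \<le> M"
proof -
  obtain l u where f: "smooth_real f" "\<And>t. t \<notin> {l..u} \<Longrightarrow> f t = 0"
    using assms by (auto simp: smooth_cc_def)
  have "compact (f ` {l..u})"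
    using f(1) by (intro compact_continuous_image smooth_real_continuous_on compact_Icc)
  then obtain M where "\<forall>y\<in>f ` {l..u}. norm y \<le> M"
    using compact_imp_bounded bounded_iff by metis
  then have M: "\<bar>f t\<bar> \<le> M" if "t \<in> {l..u}" for t
    using that by auto
  show ?thesis
  proof (rule that[of "\<bar>M\<bar>"])
    show "\<bar>f t\<bar> \<le> \<bar>M\<bar>" for t
      using M[of t] f(2)[of t] by (cases "t \<in> {l..u}") auto
  qed simp
qed

text \<open>Compact support bounds the function and its first two derivatives uniformly. The sum of
  the three bounds serves for all the estimates at once.\<close>

lemma smooth_cc_Taylor:
  assumes "smooth_cc f"
  obtains M where "M \<ge> 0" "\<And>t. \<bar>f t\<bar> \<le> M" "\<And>t. \<bar>deriv f t\<bar> \<le> M"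
    "\<And>t h. \<bar>f (t + h) - f t\<bar> \<le> M * \<bar>h\<bar>"
    "\<And>t h. \<bar>f (t + h) - f t - deriv f t * h\<bar> \<le> M * h\<^sup>2"
proof -
  have cc: "smooth_cc (deriv f)" "smooth_cc (deriv (deriv f))"
    using assms by (auto intro: smooth_cc_deriv)
  have sm: "smooth_real f" "smooth_real (deriv f)"
    using assms cc by (auto simp: smooth_cc_def)
  obtain M0 M1 M2 where M: "M0 \<ge> 0" "\<And>t. \<bar>f t\<bar> \<le> M0" "M1 \<ge> 0" "\<And>t. \<bar>deriv f t\<bar> \<le> M1"
    "M2 \<ge> 0" "\<And>t. \<bar>deriv (deriv f) t\<bar> \<le> M2"
    using smooth_cc_bounded[OF assms] smooth_cc_bounded[OF cc(1)] smooth_cc_bounded[OF cc(2)]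
    by metis
  have 1: "\<bar>f s - f t\<bar> \<le> M1 * \<bar>s - t\<bar>" for s t
    using field_differentiable_bound[of UNIV f "deriv f" M1 s t] smooth_real_DERIV[OF sm(1)] M by auto
  have 2: "\<bar>deriv f s - deriv f t\<bar> \<le> M2 * \<bar>s - t\<bar>" for s t
    using field_differentiable_bound[of UNIV "deriv f" "deriv (deriv f)" M2 s t]
      smooth_real_DERIV[OF sm(2)] M by auto
  have 3: "\<bar>f (t + h) - f t - deriv f t * h\<bar> \<le> M2 * h\<^sup>2" for t h
  proof -
    \<comment> \<open>Subtracting the tangent slope leaves a function whose derivative between
      \<open>t\<close> and \<open>t + h\<close> is at most \<open>M2 * \<bar>h\<bar>\<close>. The
      mean value inequality contributes the second factor \<open>\<bar>h\<bar>\<close>.\<close>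
    let ?g = "\<lambda>s. f s - deriv f t * s"
    have "norm (?g (t + h) - ?g t) \<le> (M2 * \<bar>h\<bar>) * norm ((t + h) - t)"
    proof (rule field_differentiable_bound[where S = "closed_segment t (t + h)" and f' = "\<lambda>s. deriv f s - deriv f t"])
      show "(?g has_real_derivative deriv f s - deriv f t) (at s within closed_segment t (t + h))" for s
        by (rule has_field_derivative_at_within)
          (auto intro!: derivative_eq_intros smooth_real_DERIV[OF sm(1)])
      fix s assume "s \<in> closed_segment t (t + h)"
      then have "\<bar>s - t\<bar> \<le> \<bar>h\<bar>"
        by (auto simp: closed_segment_eq_real_ivl split: if_splits)
      then have "M2 * \<bar>s - t\<bar> \<le> M2 * \<bar>h\<bar>" using M by (intro mult_left_mono)
      then show "norm (deriv f s - deriv f t) \<le> M2 * \<bar>h\<bar>"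
        using 2[of s t] by simp
    qed auto
    then show ?thesis by (simp add: algebra_simps power2_eq_square)
  qed
  let ?M = "M0 + M1 + M2"
  show ?thesis
  proof (rule that[of ?M])
    show "?M \<ge> 0" "\<bar>f t\<bar> \<le> ?M" "\<bar>deriv f t\<bar> \<le> ?M" for t
      using M(1,3,5) M(2,4,6)[of t] by linarith+
    show "\<bar>f (t + h) - f t\<bar> \<le> ?M * \<bar>h\<bar>" for t h
      using M by (intro order_trans[OF 1[of "t + h" t]]) (auto intro!: mult_right_mono)
    show "\<bar>f (t + h) - f t - deriv f t * h\<bar> \<le> ?M * h\<^sup>2" for t h
      using M by (intro order_trans[OF 3[of t h]]) (auto intro!: mult_right_mono)
  qed
qed

text \<open>The constant does not depend on \<open>z\<close>; this is what allows a convolution with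
  a merely integrable function to be differentiated under the integral. Besides the two one-variable
  remainders there is one mixed term, \<open>deriv a x * h * (b (y + k) - b y)\<close>, which is
  quadratic because |h||k| is at most h^2 + k^2. The factor 3 is generous.\<close>

lemma tensor_Taylor:
  assumes "smooth_cc a" "smooth_cc b"
  obtains C where "C \<ge> 0" "\<And>z. \<bar>tensor a b z\<bar> \<le> C"
    "\<And>z h. \<bar>tensor a b (z + h) - tensor a b z
        - (tensor (deriv a) b z * fst h + tensor a (deriv b) z * snd h)\<bar> \<le> C * (norm h)\<^sup>2"
proof -
  obtain A where A: "A \<ge> 0" "\<And>t. \<bar>a t\<bar> \<le> A" "\<And>t. \<bar>deriv a t\<bar> \<le> A"
    "\<And>t h. \<bar>a (t + h) - a t - deriv a t * h\<bar> \<le> A * h\<^sup>2"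
    using smooth_cc_Taylor[OF assms(1)] by metis
  obtain B where B: "B \<ge> 0" "\<And>t. \<bar>b t\<bar> \<le> B" "\<And>t h. \<bar>b (t + h) - b t\<bar> \<le> B * \<bar>h\<bar>"
    "\<And>t h. \<bar>b (t + h) - b t - deriv b t * h\<bar> \<le> B * h\<^sup>2"
    using smooth_cc_Taylor[OF assms(2)] by metis
  have main: "\<bar>a (x + h) * b (y + k) - a x * b y - (deriv a x * b y * h + a x * deriv b y * k)\<bar>
      \<le> 3 * (A * B) * (norm (h, k))\<^sup>2" for x y h k
  proof -
    have "a (x + h) * b (y + k) - a x * b y - (deriv a x * b y * h + a x * deriv b y * k)
      = (a (x + h) - a x - deriv a x * h) * b (y + k) + a x * (b (y + k) - b y - deriv b y * k)
        + deriv a x * h * (b (y + k) - b y)"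
      by (simp add: algebra_simps)
    also have "\<bar>\<dots>\<bar> \<le> (A * h\<^sup>2) * B + A * (B * k\<^sup>2) + (A * \<bar>h\<bar>) * (B * \<bar>k\<bar>)"
    proof -
      have "\<bar>p + q + r\<bar> \<le> P + Q + R" if "\<bar>p\<bar> \<le> P" "\<bar>q\<bar> \<le> Q" "\<bar>r\<bar> \<le> R" for p q r P Q R :: real
        using that by linarith
      note triangle = this
      show ?thesis
        by (rule triangle; unfold abs_mult) (intro mult_mono A B mult_nonneg_nonneg abs_ge_zero zero_le_power2 order_refl)+
    qed
    also have "\<dots> = (A * B) * (h\<^sup>2 + k\<^sup>2 + \<bar>h\<bar> * \<bar>k\<bar>)" by (simp add: algebra_simps)
    also have "\<dots> \<le> (A * B) * (3 * (h\<^sup>2 + k\<^sup>2))"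
    proof (rule mult_left_mono)
      have "\<bar>h\<bar> * \<bar>k\<bar> \<le> h\<^sup>2 + k\<^sup>2"
        using sum_squares_bound[of "\<bar>h\<bar>" "\<bar>k\<bar>"] mult_nonneg_nonneg[of "\<bar>h\<bar>" "\<bar>k\<bar>"]
        unfolding power2_abs mult.assoc by (smt (verit) abs_ge_zero)
      moreover have "0 \<le> h\<^sup>2 + k\<^sup>2" by simp
      ultimately show "h\<^sup>2 + k\<^sup>2 + \<bar>h\<bar> * \<bar>k\<bar> \<le> 3 * (h\<^sup>2 + k\<^sup>2)"
        by argo
    qed (use A B in simp)
    finally show ?thesis by (simp add: norm_prod_def algebra_simps)
  qed
  show ?thesis
  proof (rule that[of "3 * (A * B)"])
    show "\<bar>tensor a b z\<bar> \<le> 3 * (A * B)" for z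
    proof -
      have "\<bar>tensor a b z\<bar> \<le> A * B" using A B by (simp add: tensor_def abs_mult mult_mono)
      moreover have "0 \<le> A * B" using A B by simp
      ultimately show ?thesis by linarith
    qed
    show "\<bar>tensor a b (z + h) - tensor a b z
        - (tensor (deriv a) b z * fst h + tensor a (deriv b) z * snd h)\<bar> \<le> 3 * (A * B) * (norm h)\<^sup>2" for z h
      using main[of "fst z" "fst h" "snd z" "snd h"] by (simp add: tensor_def)
  qed (use A B in simp)
qed

lemma has_derivative_quadratic_remainder:
  fixes f :: "'a::real_normed_vector \<Rightarrow> real"
  assumes "bounded_linear L" and "\<And>h. \<bar>f (z + h) - f z - L h\<bar> \<le> C * (norm h)\<^sup>2"
  shows "(f has_derivative L) (at z)"
  unfolding has_derivative_at
proof (intro conjI assms(1))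
  show "(\<lambda>h. norm (f (z + h) - f z - L h) / norm h) \<midarrow>0\<rightarrow> 0"
  proof (rule Lim_null_comparison)
    show "\<forall>\<^sub>F h in at 0. norm (norm (f (z + h) - f z - L h) / norm h) \<le> C * norm h"
    proof (intro always_eventually allI)
      fix h
      show "norm (norm (f (z + h) - f z - L h) / norm h) \<le> C * norm h"
        using assms(2)[of h] by (cases "h = 0") (simp_all add: pos_divide_le_eq power2_eq_square mult.assoc)
    qed
    show "((\<lambda>h. C * norm h) \<longlongrightarrow> 0) (at 0)"
      by (auto intro!: tendsto_eq_intros)
  qed
qed

section \<open>Convolution\<close>

definition conv :: "(real \<times> real \<Rightarrow> real) \<Rightarrow> (real \<times> real \<Rightarrow> real) \<Rightarrow> real \<times> real \<Rightarrow> real" where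
  "conv K v z = (LINT w|lebesgue. v w * K (z - w))"

lemma integrable_mult_bounded:
  fixes v g :: "'a \<Rightarrow> real"
  assumes "integrable M v" "g \<in> borel_measurable M" "\<And>w. \<bar>g w\<bar> \<le> C"
  shows "integrable M (\<lambda>w. v w * g w)"
proof (rule Bochner_Integration.integrable_bound[of _ "\<lambda>w. C * v w"])
  show "AE w in M. norm (v w * g w) \<le> norm (C * v w)"
  proof (rule AE_I2)
    fix w
    have "\<bar>g w\<bar> \<le> \<bar>C\<bar>" using assms(3)[of w] by linarith
    then show "norm (v w * g w) \<le> norm (C * v w)" by (simp add: abs_mult mult_right_mono mult.commute[of "\<bar>v w\<bar>"])
  qed
qed (use assms(1,2) in \<open>simp_all add: borel_measurable_integrable\<close>)

lemma integrable_conv: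
  assumes "smooth_cc a" "smooth_cc b" "integrable lebesgue v"
  shows "integrable lebesgue (\<lambda>w. v w * tensor a b (z - w))"
proof -
  obtain C where "\<And>z. \<bar>tensor a b z\<bar> \<le> C" using tensor_Taylor[OF assms(1,2)] by metis
  moreover have "(\<lambda>w. tensor a b (z - w)) \<in> borel_measurable lebesgue"
    using assms(1,2) by (intro measurable_completion measurable_compose[OF _ tensor_measurable, of "\<lambda>w. z - w"])
      (simp_all add: smooth_cc_def)
  ultimately show ?thesis using assms(3) by (intro integrable_mult_bounded[where C = C])
qed

text \<open>The kernel has a quadratic Taylor remainder that is uniform in the shift. Integrating it
  against \<open>\<bar>v w\<bar>\<close> gives a quadratic remainder for the convolution, with
  constant the L^1 norm of \<open>v\<close> times that of the kernel. No regularity of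
  \<open>v\<close> enters.\<close>

lemma conv_has_derivative:
  assumes a: "smooth_cc a" and b: "smooth_cc b" and v: "integrable lebesgue v"
  shows "(conv (tensor a b) v has_derivative
    (\<lambda>h. conv (tensor (deriv a) b) v z * fst h + conv (tensor a (deriv b)) v z * snd h)) (at z)"
proof -
  obtain C where C: "C \<ge> 0" "\<And>z h. \<bar>tensor a b (z + h) - tensor a b z
        - (tensor (deriv a) b z * fst h + tensor a (deriv b) z * snd h)\<bar> \<le> C * (norm h)\<^sup>2"
    using tensor_Taylor[OF a b] by metis
  note int = integrable_conv[OF a b v] integrable_conv[OF smooth_cc_deriv[OF a] b v]
    integrable_conv[OF a smooth_cc_deriv[OF b] v]
  show ?thesis
  proof (rule has_derivative_quadratic_remainder)
    show "bounded_linear (\<lambda>h. conv (tensor (deriv a) b) v z * fst h + conv (tensor a (deriv b)) v z * snd h)"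
      by (intro bounded_linear_add bounded_linear_const_mult bounded_linear_fst bounded_linear_snd)
    fix h
    let ?r = "\<lambda>w. v w * (tensor a b (z + h - w) - tensor a b (z - w)
        - (tensor (deriv a) b (z - w) * fst h + tensor a (deriv b) (z - w) * snd h))"
    have eq: "conv (tensor a b) v (z + h) - conv (tensor a b) v z
        - (conv (tensor (deriv a) b) v z * fst h + conv (tensor a (deriv b)) v z * snd h)
      = (LINT w|lebesgue. ?r w)"
    proof -
      have "(LINT w|lebesgue. ?r w) = (LINT w|lebesgue. (v w * tensor a b (z + h - w) - v w * tensor a b (z - w))
          - ((v w * tensor (deriv a) b (z - w)) * fst h + (v w * tensor a (deriv b) (z - w)) * snd h))"
        by (simp only: right_diff_distrib distrib_left mult.assoc)
      then show ?thesis by (simp add: conv_def int)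
    qed
    have "\<bar>LINT w|lebesgue. ?r w\<bar> \<le> (LINT w|lebesgue. \<bar>v w\<bar> * (C * (norm h)\<^sup>2))"
    proof (rule integral_abs_bound[THEN order_trans], rule integral_mono)
      have "integrable lebesgue (\<lambda>w. (v w * tensor a b (z + h - w) - v w * tensor a b (z - w))
          - ((v w * tensor (deriv a) b (z - w)) * fst h + (v w * tensor a (deriv b) (z - w)) * snd h))"
        by (intro Bochner_Integration.integrable_diff Bochner_Integration.integrable_add integrable_mult_left int)
      also have "(\<lambda>w. (v w * tensor a b (z + h - w) - v w * tensor a b (z - w))
          - ((v w * tensor (deriv a) b (z - w)) * fst h + (v w * tensor a (deriv b) (z - w)) * snd h)) = ?r"
        by (simp only: right_diff_distrib distrib_left mult.assoc)
      finally have "integrable lebesgue ?r" .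
      then show "integrable lebesgue (\<lambda>w. \<bar>?r w\<bar>)" by (rule integrable_abs)
      show "integrable lebesgue (\<lambda>w. \<bar>v w\<bar> * (C * (norm h)\<^sup>2))"
        by (intro integrable_mult_left integrable_abs v)
      show "\<bar>?r w\<bar> \<le> \<bar>v w\<bar> * (C * (norm h)\<^sup>2)" for w
      proof -
        have eq: "z - w + h = z + h - w" by simp
        show ?thesis
          unfolding abs_mult using C(2)[of "z - w" h, unfolded eq] by (intro mult_left_mono) simp_all
      qed
    qed
    then show "\<bar>conv (tensor a b) v (z + h) - conv (tensor a b) v z
        - (conv (tensor (deriv a) b) v z * fst h + conv (tensor a (deriv b)) v z * snd h)\<bar>
        \<le> ((LINT w|lebesgue. \<bar>v w\<bar>) * C) * (norm h)\<^sup>2"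
      unfolding eq by (simp add: mult.assoc)
  qed
qed

lemma partial_conv:
  assumes "smooth_cc a" "smooth_cc b" "integrable lebesgue v"
  shows "partial (1, 0) (conv (tensor a b) v) = conv (tensor (deriv a) b) v"
    and "partial (0, 1) (conv (tensor a b) v) = conv (tensor a (deriv b)) v"
  by (rule ext, simp add: partial_eqI[OF conv_has_derivative[OF assms]])+

lemma smooth_conv:
  assumes "smooth_cc a" "smooth_cc b" and v: "integrable lebesgue v"
  shows "smooth (conv (tensor a b) v)"
proof (rule smooth_coinduct[where
      P = "\<lambda>g. \<exists>a b. smooth_cc a \<and> smooth_cc b \<and> g = conv (tensor a b) v"])
  fix g :: "real \<times> real \<Rightarrow> real" assume "\<exists>a b. smooth_cc a \<and> smooth_cc b \<and> g = conv (tensor a b) v"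
  then obtain a b where g: "smooth_cc a" "smooth_cc b" "g = conv (tensor a b) v" by blast
  show "g differentiable_on UNIV"
    using conv_has_derivative[OF g(1,2) v] g(3)
    by (meson differentiableI differentiable_at_imp_differentiable_on)
  show "\<exists>a b. smooth_cc a \<and> smooth_cc b \<and> partial c g = conv (tensor a b) v" if c: "c \<in> Basis" for c
  proof -
    consider "c = (1, 0)" | "c = (0, 1)" using c by (auto simp: Basis_plane)
    then show ?thesis
    proof cases
      case 1
      then show ?thesis unfolding g(3) 1 partial_conv(1)[OF g(1,2) v]
        using g(1,2) smooth_cc_deriv by blast
    next
      case 2
      then show ?thesis unfolding g(3) 2 partial_conv(2)[OF g(1,2) v]
        using g(1,2) smooth_cc_deriv by blast
    qed
  qed
next
  show "\<exists>a' b'. smooth_cc a' \<and> smooth_cc b' \<and> conv (tensor a b) v = conv (tensor a' b') v"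
    using assms by blast
qed

section \<open>Translations in L^1 and approximation by convolution\<close>

lemma nn_integral_lborel_affine:
  fixes t :: "'a::euclidean_space"
  assumes [measurable]: "g \<in> borel_measurable borel" and c: "c = 1 \<or> c = -1"
  shows "(\<integral>\<^sup>+z. g (t + c *\<^sub>R z) \<partial>lborel) = (\<integral>\<^sup>+z. g z \<partial>lborel)"
proof -
  have "lborel = distr lborel borel (\<lambda>z. t + c *\<^sub>R z)"
    using lborel_affine[of c t] c by (auto simp: density_1)
  then have "(\<integral>\<^sup>+z. g z \<partial>lborel) = (\<integral>\<^sup>+z. g z \<partial>distr lborel borel (\<lambda>z. t + c *\<^sub>R z))"
    by (rule arg_cong)
  also have "\<dots> = (\<integral>\<^sup>+z. g (t + c *\<^sub>R z) \<partial>lborel)"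
    by (rule nn_integral_distr) simp_all
  finally show ?thesis ..
qed

lemma nn_integral_lborel_translate:
  fixes s :: "'a::euclidean_space"
  assumes "g \<in> borel_measurable borel"
  shows "(\<integral>\<^sup>+z. g (z + s) \<partial>lborel) = (\<integral>\<^sup>+z. g z \<partial>lborel)"
  using nn_integral_lborel_affine[OF assms, of 1 s] by (simp add: add.commute)

lemma nn_integral_lborel_reflect:
  fixes s :: "'a::euclidean_space"
  assumes "g \<in> borel_measurable borel"
  shows "(\<integral>\<^sup>+z. g (s - z) \<partial>lborel) = (\<integral>\<^sup>+z. g z \<partial>lborel)"
  using nn_integral_lborel_affine[OF assms, of "-1" s] by simp

text \<open>The error is spent in three equal parts: on the outer open set, on the inner closed set,
  and on the part of \<open>A\<close> outside a large ball, which is small because \<open>A\<close>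
  has finite measure. Compactness of \<open>K\<close> yields a positive distance to the complement
  of \<open>U\<close>, and this distance controls small translations.\<close>

lemma compact_open_sandwich:
  fixes A :: "'a::euclidean_space set"
  assumes A: "A \<in> sets lborel" "emeasure lborel A < \<infinity>" and e: "e > 0"
  obtains K U where "compact K" "open U" "K \<subseteq> A" "A \<subseteq> U" "emeasure lborel (U - K) \<le> ennreal e"
proof -
  have [measurable]: "A \<in> sets borel" using A by simp
  have e3: "e/3 > 0" using e by simp
  have Aleb: "A \<in> sets lebesgue" using A(1) by blast
  obtain U where U: "open U" "A \<subseteq> U" "emeasure lebesgue (U - A) < ennreal (e/3)"
    by (rule sets_lebesgue_outer_open[OF Aleb e3])
  obtain C where C: "closed C" "C \<subseteq> A" "emeasure lebesgue (A - C) < ennreal (e/3)"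
    by (rule sets_lebesgue_inner_closed[OF Aleb e3])
  have [measurable]: "U \<in> sets borel" "C \<in> sets borel" using U(1) C(1) by simp_all
  have UA: "emeasure lborel (U - A) \<le> ennreal (e/3)" and AC: "emeasure lborel (A - C) \<le> ennreal (e/3)"
    using less_imp_le[OF U(3)] less_imp_le[OF C(3)] by simp_all
  have "(\<lambda>n. emeasure lborel (A - cball 0 (real n))) \<longlonglongrightarrow> emeasure lborel (\<Inter>n. A - cball 0 (real n))"
  proof (rule Lim_emeasure_decseq)
    show "decseq (\<lambda>n. A - cball 0 (real n))"
      by (auto simp: decseq_def)
    show "emeasure lborel (A - cball 0 (real n)) \<noteq> \<infinity>" for n
      using neq_top_trans[OF _ emeasure_mono[of "A - cball 0 (real n)" A lborel]] A by simp
  qed auto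
  moreover have "(\<Inter>n. A - cball 0 (real n)) = {}"
  proof -
    have "\<exists>n. z \<in> cball 0 (real n)" for z :: 'a
      using real_arch_simple[of "norm z"] by simp
    then show ?thesis by blast
  qed
  ultimately have "(\<lambda>n. emeasure lborel (A - cball 0 (real n))) \<longlonglongrightarrow> 0"
    by (simp only: emeasure_empty)
  then have "\<forall>\<^sub>F n in sequentially. emeasure lborel (A - cball 0 (real n)) < ennreal (e/3)"
    by (rule order_tendstoD(2)) (use e in simp)
  then obtain n where n: "emeasure lborel (A - cball 0 (real n)) < ennreal (e/3)"
    using eventually_happens'[OF sequentially_bot] by blast
  show ?thesis
  proof
    show "compact (C \<inter> cball 0 (real n))" using C(1) by (simp add: closed_Int_compact)
    have "emeasure lborel (U - C \<inter> cball 0 (real n))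
        \<le> emeasure lborel ((U - A) \<union> ((A - C) \<union> (A - cball 0 (real n))))"
    proof (rule emeasure_mono)
      show "U - C \<inter> cball 0 (real n) \<subseteq> (U - A) \<union> ((A - C) \<union> (A - cball 0 (real n)))" by blast
    qed simp
    also have "\<dots> \<le> emeasure lborel (U - A) + (emeasure lborel (A - C) + emeasure lborel (A - cball 0 (real n)))"
    proof -
      have "emeasure lborel ((A - C) \<union> (A - cball 0 (real n))) \<le> emeasure lborel (A - C) + emeasure lborel (A - cball 0 (real n))"
        by (rule emeasure_subadditive) simp_all
      moreover have "emeasure lborel ((U - A) \<union> ((A - C) \<union> (A - cball 0 (real n))))
          \<le> emeasure lborel (U - A) + emeasure lborel ((A - C) \<union> (A - cball 0 (real n)))"
        by (rule emeasure_subadditive) simp_all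
      ultimately show ?thesis using add_left_mono order_trans by blast
    qed
    also have "\<dots> \<le> ennreal (e/3) + (ennreal (e/3) + ennreal (e/3))"
      by (intro add_mono UA AC less_imp_le[OF n])
    also have "\<dots> = ennreal e" using e by (simp flip: ennreal_plus)
    finally show "emeasure lborel (U - C \<inter> cball 0 (real n)) \<le> ennreal e" .
    show "open U" "A \<subseteq> U" "C \<inter> cball 0 (real n) \<subseteq> A"
      using U(1,2) C(2) by blast+
  qed
qed

text \<open>The property passes from indicators to sums and to L^1 limits. In the limit step the
  error of the translated function equals that of the original one by translation invariance, so
  three errors of size \<open>e/3\<close> suffice.\<close>

lemma L1_translation_continuous:
  fixes f :: "'a::euclidean_space \<Rightarrow> real"
  assumes "integrable lborel f"
  shows "\<forall>e>0. \<exists>d>0. \<forall>s. norm s \<le> d \<longrightarrow> (\<integral>\<^sup>+z. ennreal \<bar>f (z + s) - f z\<bar> \<partial>lborel) \<le> ennreal e"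
  using assms
proof (induction rule: integrable_induct)
  case (base A c)
  have [measurable]: "A \<in> sets borel" using base(1) by simp
  show ?case
  proof (intro allI impI)
    fix e :: real assume e: "e > 0"
    \<comment> \<open>The added 1 covers \<open>c = 0\<close>; the half is there because
      \<open>U - K\<close> is counted twice, once as it stands and once translated.\<close>
    define e' where "e' = e / (\<bar>c\<bar> + 1) / 2"
    have e'0: "e' > 0" using e by (simp add: e'_def add_nonneg_pos)
    have "e' + e' = e / (\<bar>c\<bar> + 1)" unfolding e'_def by (rule field_sum_of_halves)
    moreover have "\<bar>c\<bar> + 1 \<noteq> 0" by linarith
    ultimately have "(\<bar>c\<bar> + 1) * (e' + e') = e" by simp
    moreover have "\<bar>c\<bar> * (e' + e') \<le> (\<bar>c\<bar> + 1) * (e' + e')" using e'0 by (intro mult_right_mono) auto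
    ultimately have e': "e' > 0" "\<bar>c\<bar> * (e' + e') \<le> e" using e'0 by simp_all
    obtain K U where KU: "compact K" "open U" "K \<subseteq> A" "A \<subseteq> U" "emeasure lborel (U - K) \<le> ennreal e'"
      by (rule compact_open_sandwich[OF base e'(1)])
    have [measurable]: "U - K \<in> sets borel" using KU(1,2) by (simp add: compact_imp_closed)
    obtain \<delta> where \<delta>: "\<delta> > 0" "\<forall>x\<in>K. \<forall>y\<in>- U. \<delta> \<le> dist x y"
    proof -
      have "K \<inter> - U = {}" using KU(3,4) by blast
      then show ?thesis
        using separate_compact_closed[of K "- U"] KU(1,2) that by (metis closed_Compl)
    qed
    show "\<exists>d>0. \<forall>s. norm s \<le> d \<longrightarrow>
        (\<integral>\<^sup>+z. ennreal \<bar>indicator A (z + s) *\<^sub>R c - indicator A z *\<^sub>R c\<bar> \<partial>lborel) \<le> ennreal e"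
    proof (intro exI[of _ "\<delta>/2"] conjI allI impI)
      fix s :: 'a assume s: "norm s \<le> \<delta>/2"
      have close: "y \<in> U" if "x \<in> K" "dist x y = norm s" for x y
      proof (rule ccontr)
        assume "y \<notin> U"
        then have "\<delta> \<le> dist x y" using \<delta>(2) that(1) by blast
        then have "\<delta> \<le> norm s" unfolding that(2) .
        then show False using s \<delta>(1) by linarith
      qed
      \<comment> \<open>A shift shorter than the distance between \<open>K\<close> and the
        complement of \<open>U\<close> cannot carry a point of \<open>K\<close> out of
        \<open>U\<close>. So if exactly one of \<open>z\<close> and \<open>z + s\<close> lies in
        \<open>A\<close>, at least one of the two lies in \<open>U - K\<close>.\<close>
      have "ennreal \<bar>indicator A (z + s) *\<^sub>R c - indicator A z *\<^sub>R c\<bar>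
          \<le> ennreal \<bar>c\<bar> * (indicator (U - K) (z + s) + indicator (U - K) z)" for z
      proof -
        have "z \<in> U" if "z + s \<in> K" using close[OF that, of z] by (simp add: dist_norm)
        moreover have "z + s \<in> U" if "z \<in> K" using close[OF that, of "z + s"] by (simp add: dist_norm)
        ultimately show ?thesis
          using KU(3,4) by (auto simp: indicator_def distrib_left)
      qed
      then have "(\<integral>\<^sup>+z. ennreal \<bar>indicator A (z + s) *\<^sub>R c - indicator A z *\<^sub>R c\<bar> \<partial>lborel)
          \<le> (\<integral>\<^sup>+z. ennreal \<bar>c\<bar> * (indicator (U - K) (z + s) + indicator (U - K) z) \<partial>lborel)"
        by (rule nn_integral_mono)
      also have "\<dots> = ennreal \<bar>c\<bar> * ((\<integral>\<^sup>+z. indicator (U - K) (z + s) \<partial>lborel) + (\<integral>\<^sup>+z. indicator (U - K) z \<partial>lborel))"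
        by (simp add: nn_integral_cmult nn_integral_add)
      also have "(\<integral>\<^sup>+z. indicator (U - K) (z + s) \<partial>lborel) = (\<integral>\<^sup>+z. indicator (U - K) z \<partial>lborel)"
        by (rule nn_integral_lborel_translate) simp
      also have "(\<integral>\<^sup>+z. indicator (U - K) z \<partial>lborel) = emeasure lborel (U - K)"
        by simp
      also have "ennreal \<bar>c\<bar> * (emeasure lborel (U - K) + emeasure lborel (U - K)) \<le> ennreal \<bar>c\<bar> * (ennreal e' + ennreal e')"
        by (intro mult_left_mono add_mono KU) auto
      also have "\<dots> = ennreal (\<bar>c\<bar> * (e' + e'))"
      proof -
        have "ennreal (\<bar>c\<bar> * (e' + e')) = ennreal \<bar>c\<bar> * ennreal (e' + e')"
          by (rule ennreal_mult) (use e'(1) in simp_all)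
        moreover have "ennreal (e' + e') = ennreal e' + ennreal e'"
          by (rule ennreal_plus) (use e'(1) in simp_all)
        ultimately show ?thesis by (simp only:)
      qed
      also have "\<dots> \<le> ennreal e" using e' by (intro ennreal_leI)
      finally show "(\<integral>\<^sup>+z. ennreal \<bar>indicator A (z + s) *\<^sub>R c - indicator A z *\<^sub>R c\<bar> \<partial>lborel) \<le> ennreal e" .
    qed (use \<delta>(1) in simp)
  qed
next
  case (add f g)
  have [measurable]: "f \<in> borel_measurable borel" "g \<in> borel_measurable borel"
    using add.hyps by auto
  show ?case
  proof (intro allI impI)
    fix e :: real assume e: "e > 0"
    obtain d1 where d1: "d1 > 0" "\<forall>s. norm s \<le> d1 \<longrightarrow> (\<integral>\<^sup>+z. ennreal \<bar>f (z + s) - f z\<bar> \<partial>lborel) \<le> ennreal (e/2)"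
      using add.IH(1) e half_gt_zero by metis
    obtain d2 where d2: "d2 > 0" "\<forall>s. norm s \<le> d2 \<longrightarrow> (\<integral>\<^sup>+z. ennreal \<bar>g (z + s) - g z\<bar> \<partial>lborel) \<le> ennreal (e/2)"
      using add.IH(2) e half_gt_zero by metis
    show "\<exists>d>0. \<forall>s. norm s \<le> d \<longrightarrow> (\<integral>\<^sup>+z. ennreal \<bar>f (z + s) + g (z + s) - (f z + g z)\<bar> \<partial>lborel) \<le> ennreal e"
    proof (intro exI[of _ "min d1 d2"] conjI allI impI)
      fix s :: 'a assume s: "norm s \<le> min d1 d2"
      have "(\<integral>\<^sup>+z. ennreal \<bar>f (z + s) + g (z + s) - (f z + g z)\<bar> \<partial>lborel)
          \<le> (\<integral>\<^sup>+z. ennreal \<bar>f (z + s) - f z\<bar> + ennreal \<bar>g (z + s) - g z\<bar> \<partial>lborel)"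
        by (intro nn_integral_mono) (auto simp flip: ennreal_plus intro!: ennreal_leI)
      also have "\<dots> = (\<integral>\<^sup>+z. ennreal \<bar>f (z + s) - f z\<bar> \<partial>lborel) + (\<integral>\<^sup>+z. ennreal \<bar>g (z + s) - g z\<bar> \<partial>lborel)"
        by (rule nn_integral_add) simp_all
      also have "\<dots> \<le> ennreal (e/2) + ennreal (e/2)"
        using d1(2) d2(2) s by (intro add_mono) simp_all
      also have "\<dots> = ennreal e" using e by (simp flip: ennreal_plus)
      finally show "(\<integral>\<^sup>+z. ennreal \<bar>f (z + s) + g (z + s) - (f z + g z)\<bar> \<partial>lborel) \<le> ennreal e" .
    qed (use d1(1) d2(1) in simp)
  qed
next
  case (lim f s)
  have [measurable]: "f \<in> borel_measurable borel" "s i \<in> borel_measurable borel" for i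
    using lim.hyps(4) lim.hyps(1)[of i] by auto
  show ?case
  proof (intro allI impI)
    fix e :: real assume e: "e > 0"
    have "(\<lambda>i. (\<integral>\<^sup>+z. norm (f z - s i z) \<partial>lborel)) \<longlonglongrightarrow> 0"
    proof (rule nn_integral_dominated_convergence_norm[where w = "\<lambda>z. 2 * norm (f z)"])
      have "(\<integral>\<^sup>+z. ennreal (2 * norm (f z)) \<partial>lborel) = 2 * (\<integral>\<^sup>+z. ennreal (norm (f z)) \<partial>lborel)"
        by (subst nn_integral_cmult[symmetric]) (auto simp: ennreal_mult)
      also have "\<dots> < \<infinity>"
        using lim.hyps(4) by (auto simp: integrable_iff_bounded ennreal_mult_less_top)
      finally show "(\<integral>\<^sup>+z. ennreal (2 * norm (f z)) \<partial>lborel) < \<infinity>" .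
      show "AE z in lborel. norm (s j z) \<le> 2 * norm (f z)" for j
        using lim.hyps(3) by (intro AE_I2)
      show "AE z in lborel. (\<lambda>i. s i z) \<longlonglongrightarrow> f z"
        using lim.hyps(2) by (intro AE_I2)
    qed simp_all
    then have "\<forall>\<^sub>F i in sequentially. (\<integral>\<^sup>+z. norm (f z - s i z) \<partial>lborel) < ennreal (e/3)"
      by (rule order_tendstoD(2)) (use e in simp)
    then obtain i where i: "(\<integral>\<^sup>+z. ennreal \<bar>f z - s i z\<bar> \<partial>lborel) < ennreal (e/3)"
      using eventually_happens'[OF sequentially_bot] by force
    have "e/3 > 0" using e by simp
    then obtain d where d: "d > 0" "\<forall>h. norm h \<le> d \<longrightarrow> (\<integral>\<^sup>+z. ennreal \<bar>s i (z + h) - s i z\<bar> \<partial>lborel) \<le> ennreal (e/3)"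
      using lim.IH[of i] by blast
    show "\<exists>d>0. \<forall>h. norm h \<le> d \<longrightarrow> (\<integral>\<^sup>+z. ennreal \<bar>f (z + h) - f z\<bar> \<partial>lborel) \<le> ennreal e"
    proof (intro exI[of _ d] conjI allI impI)
      fix h :: 'a assume h: "norm h \<le> d"
      have "(\<integral>\<^sup>+z. ennreal \<bar>f (z + h) - f z\<bar> \<partial>lborel)
          \<le> (\<integral>\<^sup>+z. ennreal \<bar>f (z + h) - s i (z + h)\<bar> + (ennreal \<bar>s i (z + h) - s i z\<bar> + ennreal \<bar>f z - s i z\<bar>) \<partial>lborel)"
        by (intro nn_integral_mono) (auto simp flip: ennreal_plus intro!: ennreal_leI)
      also have "\<dots> = (\<integral>\<^sup>+z. ennreal \<bar>f (z + h) - s i (z + h)\<bar> \<partial>lborel)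
          + ((\<integral>\<^sup>+z. ennreal \<bar>s i (z + h) - s i z\<bar> \<partial>lborel) + (\<integral>\<^sup>+z. ennreal \<bar>f z - s i z\<bar> \<partial>lborel))"
        by (simp add: nn_integral_add)
      also have "(\<integral>\<^sup>+z. ennreal \<bar>f (z + h) - s i (z + h)\<bar> \<partial>lborel) = (\<integral>\<^sup>+z. ennreal \<bar>f z - s i z\<bar> \<partial>lborel)"
        by (rule nn_integral_lborel_translate[where g = "\<lambda>z. ennreal \<bar>f z - s i z\<bar>"]) simp
      also have "(\<integral>\<^sup>+z. ennreal \<bar>f z - s i z\<bar> \<partial>lborel) + ((\<integral>\<^sup>+z. ennreal \<bar>s i (z + h) - s i z\<bar> \<partial>lborel)
          + (\<integral>\<^sup>+z. ennreal \<bar>f z - s i z\<bar> \<partial>lborel)) \<le> ennreal (e/3) + (ennreal (e/3) + ennreal (e/3))"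
        using less_imp_le[OF i] d(2) h by (intro add_mono) simp_all
      also have "\<dots> = ennreal e" using e by (simp flip: ennreal_plus)
      finally show "(\<integral>\<^sup>+z. ennreal \<bar>f (z + h) - f z\<bar> \<partial>lborel) \<le> ennreal e" .
    qed (use d(1) in simp)
  qed
qed

lemma ennreal_tendsto_0I:
  fixes f :: "'a \<Rightarrow> ennreal"
  assumes "\<And>e. e > 0 \<Longrightarrow> \<forall>\<^sub>F n in F. f n \<le> ennreal e"
  shows "(f \<longlongrightarrow> 0) F"
proof (rule order_tendstoI)
  fix a :: ennreal assume "0 < a"
  obtain e where "e > 0" "ennreal e < a"
  proof (cases a)
    case (real x)
    then show ?thesis using \<open>0 < a\<close> that[of "x/2"] by (auto simp: ennreal_less_iff)
  next
    case top
    then show ?thesis using that[of 1] by simp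
  qed
  then show "\<forall>\<^sub>F n in F. f n < a"
    using assms[of e] by (auto elim!: eventually_mono)
qed auto

text \<open>Exchanging integrals and substituting translations are carried out for Borel functions;
  this passes from the Lebesgue measurable functions of the Sobolev spaces to such
  representatives.\<close>

lemma lebesgue_integrable_borel_version:
  fixes v :: "'a::euclidean_space \<Rightarrow> real"
  assumes "integrable lebesgue v"
  obtains v' where "integrable lborel v'" "AE z in lebesgue. v z = v' z"
proof -
  have "v \<in> borel_measurable lebesgue" using assms by simp
  then obtain v' where v': "v' \<in> borel_measurable lborel" "AE z in lborel. v z = v' z"
    using completion_ex_borel_measurable_real by blast
  have ae: "AE z in lebesgue. v z = v' z" using v'(2) by (rule AE_completion)
  have "integrable lebesgue v'"
    using assms ae measurable_completion[OF v'(1)] borel_measurable_integrable[OF assms]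
    by (subst integrable_cong_AE[where g = v]) (auto elim: eventually_mono)
  then have "integrable lborel v'" using v'(1) integrable_completion by blast
  then show ?thesis using ae that by blast
qed

text \<open>As the kernel has integral 1, \<open>conv K v z - v z\<close> is the integral of
  \<open>v w - v z\<close> against \<open>K (z - w)\<close>. After substituting
  \<open>s = z - w\<close> and exchanging the integrals, the L^1 norm is bounded by the
  \<open>K\<close>-average of the translation errors, which have to be small only where
  \<open>K\<close> does not vanish.\<close>

lemma conv_L1_bound:
  assumes v: "integrable lborel v"
    and K: "K \<in> borel_measurable borel" "\<And>z. 0 \<le> K z" "(\<integral>\<^sup>+z. ennreal (K z) \<partial>lborel) = 1"
    and int: "\<And>z. integrable lebesgue (\<lambda>w. v w * K (z - w))"
    and mod: "\<And>s. K s \<noteq> 0 \<Longrightarrow> (\<integral>\<^sup>+z. ennreal \<bar>v (z + s) - v z\<bar> \<partial>lborel) \<le> e"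
  shows "(\<integral>\<^sup>+z. ennreal \<bar>conv K v z - v z\<bar> \<partial>lebesgue) \<le> e"
proof -
  have [measurable]: "v \<in> borel_measurable borel" "K \<in> borel_measurable borel"
    using v K(1) by auto
  have pointwise: "ennreal \<bar>conv K v z - v z\<bar> \<le> (\<integral>\<^sup>+w. ennreal (\<bar>v w - v z\<bar> * K (z - w)) \<partial>lborel)" for z
  proof -
    have K1: "(\<integral>\<^sup>+w. ennreal (K (z - w)) \<partial>lborel) = 1"
      using nn_integral_lborel_reflect[of "\<lambda>w. ennreal (K w)" z] K(3) by simp
    have Ki: "integrable lborel (\<lambda>w. K (z - w))"
      using K1 K(2) by (intro integrableI_nonneg) auto
    have KI: "(LINT w|lborel. K (z - w)) = 1"
      using K1 K(2) by (subst integral_eq_nn_integral) auto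
    have vK: "integrable lborel (\<lambda>w. v w * K (z - w))"
      using int[of z] by (subst (asm) integrable_completion) auto
    have "conv K v z = (LINT w|lborel. v w * K (z - w))"
      unfolding conv_def by (rule integral_completion) simp
    then have "conv K v z - v z = (LINT w|lborel. v w * K (z - w)) - v z * (LINT w|lborel. K (z - w))"
      by (simp add: KI)
    also have "\<dots> = (LINT w|lborel. v w * K (z - w) - v z * K (z - w))"
      using vK Ki by simp
    finally have "ennreal \<bar>conv K v z - v z\<bar> = ennreal (norm (LINT w|lborel. v w * K (z - w) - v z * K (z - w)))"
      by simp
    also have "\<dots> \<le> (\<integral>\<^sup>+w. ennreal (norm (v w * K (z - w) - v z * K (z - w))) \<partial>lborel)"
      using vK Ki by (intro integral_norm_bound_ennreal) simp
    also have "\<dots> = (\<integral>\<^sup>+w. ennreal (\<bar>v w - v z\<bar> * K (z - w)) \<partial>lborel)"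
      using K(2) by (intro nn_integral_cong) (simp add: abs_mult flip: left_diff_distrib)
    finally show ?thesis .
  qed
  have "(\<integral>\<^sup>+z. ennreal \<bar>conv K v z - v z\<bar> \<partial>lebesgue)
      \<le> (\<integral>\<^sup>+z. (\<integral>\<^sup>+w. ennreal (\<bar>v w - v z\<bar> * K (z - w)) \<partial>lborel) \<partial>lborel)"
    unfolding nn_integral_completion by (intro nn_integral_mono pointwise)
  also have "\<dots> = (\<integral>\<^sup>+w. (\<integral>\<^sup>+z. ennreal (\<bar>v w - v z\<bar> * K (z - w)) \<partial>lborel) \<partial>lborel)"
    by (rule lborel_pair.Fubini') simp
  also have "\<dots> = (\<integral>\<^sup>+w. (\<integral>\<^sup>+s. ennreal (\<bar>v w - v (s + w)\<bar> * K s) \<partial>lborel) \<partial>lborel)"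
  proof (rule nn_integral_cong)
    fix w
    show "(\<integral>\<^sup>+z. ennreal (\<bar>v w - v z\<bar> * K (z - w)) \<partial>lborel) = (\<integral>\<^sup>+s. ennreal (\<bar>v w - v (s + w)\<bar> * K s) \<partial>lborel)"
      using nn_integral_lborel_translate[of "\<lambda>z. ennreal (\<bar>v w - v z\<bar> * K (z - w))" w] by simp
  qed
  also have "\<dots> = (\<integral>\<^sup>+s. (\<integral>\<^sup>+w. ennreal (\<bar>v w - v (s + w)\<bar> * K s) \<partial>lborel) \<partial>lborel)"
    by (rule lborel_pair.Fubini') simp
  also have "\<dots> \<le> (\<integral>\<^sup>+s. e * ennreal (K s) \<partial>lborel)"
  proof (rule nn_integral_mono)
    fix s
    have "(\<integral>\<^sup>+w. ennreal (\<bar>v w - v (s + w)\<bar> * K s) \<partial>lborel)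
        = (\<integral>\<^sup>+w. ennreal \<bar>v (w + s) - v w\<bar> * ennreal (K s) \<partial>lborel)"
      using K(2) by (intro nn_integral_cong) (simp add: ennreal_mult abs_minus_commute add.commute)
    also have "\<dots> = (\<integral>\<^sup>+w. ennreal \<bar>v (w + s) - v w\<bar> \<partial>lborel) * ennreal (K s)"
      by (rule nn_integral_multc) simp
    also have "\<dots> \<le> e * ennreal (K s)"
      using mod[of s] by (cases "K s = 0") (auto intro: mult_right_mono)
    finally show "(\<integral>\<^sup>+w. ennreal (\<bar>v w - v (s + w)\<bar> * K s) \<partial>lborel) \<le> e * ennreal (K s)" .
  qed
  also have "\<dots> = e" using K(3) by (simp add: nn_integral_cmult)
  finally show ?thesis .
qed

lemma conv_tendsto_L1:
  assumes v: "integrable lebesgue v"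
    and K: "\<And>n. K n \<in> borel_measurable borel" "\<And>n z. 0 \<le> K n z"
      "\<And>n. (\<integral>\<^sup>+z. ennreal (K n z) \<partial>lborel) = 1"
    and int: "\<And>n z. integrable lebesgue (\<lambda>w. v w * K n (z - w))"
    and supp: "\<And>n z. K n z \<noteq> 0 \<Longrightarrow> norm z \<le> r n" and r: "r \<longlonglongrightarrow> 0"
  shows "(\<lambda>n. \<integral>\<^sup>+z. ennreal \<bar>conv (K n) v z - v z\<bar> \<partial>lebesgue) \<longlonglongrightarrow> 0"
proof -
  obtain v' where v': "integrable lborel v'" "AE z in lebesgue. v z = v' z"
    using lebesgue_integrable_borel_version[OF v] by blast
  have mv: "v \<in> borel_measurable lebesgue" "v' \<in> borel_measurable lebesgue"
    by (rule borel_measurable_integrable[OF v], rule measurable_completion[OF borel_measurable_integrable[OF v'(1)]])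
  have mK: "(\<lambda>w. K n (z - w)) \<in> borel_measurable lebesgue" for n z
    using K(1) by (intro measurable_completion measurable_compose[OF _ K(1), of "\<lambda>w. z - w"]) simp
  \<comment> \<open>Each value of a convolution is an integral, so replacing \<open>v\<close> by an
    a.e. equal function changes it at no point at all.\<close>
  have conv_eq: "conv (K n) v = conv (K n) v'" for n
    unfolding conv_def using v'(2) mv mK
    by (intro ext integral_cong_AE borel_measurable_times) (auto elim: eventually_mono)
  have int': "integrable lebesgue (\<lambda>w. v' w * K n (z - w))" for n z
    using int[of n z] v'(2) mv mK
    by (subst integrable_cong_AE[where g = "\<lambda>w. v w * K n (z - w)"])
      (auto elim: eventually_mono intro!: borel_measurable_times)
  have eq: "(\<integral>\<^sup>+z. ennreal \<bar>conv (K n) v z - v z\<bar> \<partial>lebesgue) = (\<integral>\<^sup>+z. ennreal \<bar>conv (K n) v' z - v' z\<bar> \<partial>lebesgue)" for n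
    unfolding conv_eq using v'(2) by (intro nn_integral_cong_AE) (auto elim: eventually_mono)
  show ?thesis
    unfolding eq
  proof (rule ennreal_tendsto_0I)
    fix e :: real assume "e > 0"
    then obtain d where d: "d > 0"
      "\<forall>s. norm s \<le> d \<longrightarrow> (\<integral>\<^sup>+z. ennreal \<bar>v' (z + s) - v' z\<bar> \<partial>lborel) \<le> ennreal e"
      using L1_translation_continuous[OF v'(1)] by blast
    have "\<forall>\<^sub>F n in sequentially. r n < d"
      using order_tendstoD(2)[OF r d(1)] .
    then show "\<forall>\<^sub>F n in sequentially. (\<integral>\<^sup>+z. ennreal \<bar>conv (K n) v' z - v' z\<bar> \<partial>lebesgue) \<le> ennreal e"
    proof (rule eventually_mono)
      fix n assume "r n < d"
      then have "(\<integral>\<^sup>+z. ennreal \<bar>v' (z + s) - v' z\<bar> \<partial>lborel) \<le> ennreal e" if "K n s \<noteq> 0" for s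
        using d(2)[rule_format, of s] supp[OF that] by linarith
      then show "(\<integral>\<^sup>+z. ennreal \<bar>conv (K n) v' z - v' z\<bar> \<partial>lebesgue) \<le> ennreal e"
        by (rule conv_L1_bound[OF v'(1) K int'])
    qed
  qed
qed

section \<open>A directed approximate identity on the plane\<close>

definition bump :: "nat \<Rightarrow> real \<Rightarrow> real" where
  "bump n = (SOME \<eta>. smooth_real \<eta> \<and> (\<forall>t. 0 \<le> \<eta> t) \<and>
     (\<forall>t. t \<notin> {1 / Suc n / 2..1 / Suc n} \<longrightarrow> \<eta> t = 0) \<and> (\<integral>\<^sup>+t. ennreal (\<eta> t) \<partial>lborel) = 1)"

lemma smooth_real_bump: "smooth_real (bump n)"
  and bump_nonneg: "0 \<le> bump n t"
  and bump_eq_0: "t \<notin> {1 / Suc n / 2..1 / Suc n} \<Longrightarrow> bump n t = 0"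
  and nn_integral_bump: "(\<integral>\<^sup>+t. ennreal (bump n t) \<partial>lborel) = 1"
proof -
  have "0 < 1 / real (Suc n)" by simp
  then obtain \<eta> where "smooth_real \<eta>" "\<And>t. 0 \<le> \<eta> t"
    "\<And>t. t \<notin> {1 / real (Suc n) / 2..1 / real (Suc n)} \<Longrightarrow> \<eta> t = 0" "(\<integral>\<^sup>+t. ennreal (\<eta> t) \<partial>lborel) = 1"
    by (rule exists_mollifier) (rule that)
  then have "\<exists>\<eta>. smooth_real \<eta> \<and> (\<forall>t. 0 \<le> \<eta> t) \<and>
     (\<forall>t. t \<notin> {1 / Suc n / 2..1 / Suc n} \<longrightarrow> \<eta> t = 0) \<and> (\<integral>\<^sup>+t. ennreal (\<eta> t) \<partial>lborel) = 1"
    by blast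
  from someI_ex[OF this]
  have "smooth_real (bump n) \<and> (\<forall>t. 0 \<le> bump n t) \<and>
     (\<forall>t. t \<notin> {1 / Suc n / 2..1 / Suc n} \<longrightarrow> bump n t = 0) \<and> (\<integral>\<^sup>+t. ennreal (bump n t) \<partial>lborel) = 1"
    unfolding bump_def .
  then show "smooth_real (bump n)" "0 \<le> bump n t"
    "t \<notin> {1 / Suc n / 2..1 / Suc n} \<Longrightarrow> bump n t = 0" "(\<integral>\<^sup>+t. ennreal (bump n t) \<partial>lborel) = 1"
    by blast+
qed

lemma smooth_cc_bump: "smooth_cc (bump n)"
  unfolding smooth_cc_def using smooth_real_bump bump_eq_0 by blast

lemma smooth_cc_bump_minus: "smooth_cc (\<lambda>t. bump n (- t))"
proof -
  have "smooth_real (\<lambda>t. bump n (- t))"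
    using smooth_real_affine[OF smooth_real_bump, of n "-1" 0] by simp
  moreover have "bump n (- t) = 0" if "t \<notin> {- (1 / Suc n).. - (1 / Suc n / 2)}" for t
    using that by (intro bump_eq_0) auto
  ultimately show ?thesis unfolding smooth_cc_def by blast
qed

text \<open>
  The support lies in \<open>x > 0\<close>, \<open>y < 0\<close>: the convolution at \<open>z\<close> only sees values to the
  left of and above \<open>z\<close>, so it can be evaluated up to the base and the right side of the strip.
\<close>

definition mollifier :: "nat \<Rightarrow> real \<times> real \<Rightarrow> real" where
  "mollifier n = tensor (bump n) (\<lambda>t. bump n (- t))"

text \<open>As a function of \<open>w\<close> the shifted kernel is again a product of bumps. Its
  first factor vanishes to the right of \<open>fst z\<close> and its second one below
  \<open>snd z\<close>, so it can be inserted as a test function.\<close>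

lemma mollifier_shift:
  "mollifier n (z - w) = tensor (\<lambda>t. bump n (fst z - t)) (\<lambda>t. bump n (t - snd z)) w"
  by (simp add: mollifier_def tensor_def)

lemma mollifier_measurable [measurable]: "mollifier n \<in> borel_measurable borel"
  unfolding mollifier_def using smooth_cc_bump smooth_cc_bump_minus
  by (intro tensor_measurable) (auto simp: smooth_cc_def)

lemma mollifier_nonneg: "0 \<le> mollifier n z"
  by (simp add: mollifier_def tensor_def bump_nonneg)

lemma nn_integral_mollifier: "(\<integral>\<^sup>+z. ennreal (mollifier n z) \<partial>lborel) = 1"
proof -
  have [measurable]: "bump n \<in> borel_measurable borel"
    using smooth_real_bump by (rule smooth_real_measurable)
  have "(\<integral>\<^sup>+z. ennreal (mollifier n z) \<partial>lborel) = (\<integral>\<^sup>+z. ennreal (mollifier n z) \<partial>(lborel \<Otimes>\<^sub>M lborel))"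
    by (simp add: lborel_prod)
  also have "\<dots> = (\<integral>\<^sup>+x. (\<integral>\<^sup>+y. ennreal (mollifier n (x, y)) \<partial>lborel) \<partial>lborel)"
    by (rule lborel.nn_integral_fst[symmetric]) (simp add: lborel_prod)
  also have "\<dots> = (\<integral>\<^sup>+x. ennreal (bump n x) * (\<integral>\<^sup>+y. ennreal (bump n (0 - y)) \<partial>lborel) \<partial>lborel)"
    by (intro nn_integral_cong) (simp add: mollifier_def tensor_def ennreal_mult bump_nonneg nn_integral_cmult)
  also have "(\<integral>\<^sup>+y. ennreal (bump n (0 - y)) \<partial>lborel) = 1"
    using nn_integral_lborel_reflect[of "\<lambda>y. ennreal (bump n y)" 0] nn_integral_bump by simp
  finally show ?thesis by (simp add: nn_integral_bump)
qed

lemma mollifier_support: "mollifier n z \<noteq> 0 \<Longrightarrow> norm z \<le> 2 / Suc n"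
proof -
  assume "mollifier n z \<noteq> 0"
  then have "fst z \<in> {1 / Suc n / 2..1 / Suc n}" "- snd z \<in> {1 / Suc n / 2..1 / Suc n}"
    using bump_eq_0 by (auto simp: mollifier_def tensor_def)
  moreover have "\<bar>s\<bar> \<le> r" if "s \<in> {r / 2..r} \<or> - s \<in> {r / 2..r}" for s r :: real
    using that by auto
  ultimately have "\<bar>fst z\<bar> \<le> 1 / Suc n" "\<bar>snd z\<bar> \<le> 1 / Suc n" by blast+
  then show ?thesis
    using norm_Pair_le[of "fst z" "snd z"] by simp
qed

lemma integrable_conv_mollifier:
  "integrable lebesgue v \<Longrightarrow> integrable lebesgue (\<lambda>w. v w * mollifier n (z - w))"
  unfolding mollifier_def by (rule integrable_conv[OF smooth_cc_bump smooth_cc_bump_minus])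

lemma conv_mollifier_tendsto_L1:
  assumes "integrable lebesgue v"
  shows "(\<lambda>n. \<integral>\<^sup>+z. ennreal \<bar>conv (mollifier n) v z - v z\<bar> \<partial>lebesgue) \<longlonglongrightarrow> 0"
proof (rule conv_tendsto_L1[OF assms mollifier_measurable mollifier_nonneg nn_integral_mollifier
      integrable_conv_mollifier[OF assms] mollifier_support])
  have "(\<lambda>n. 2 * inverse (real (Suc n))) \<longlonglongrightarrow> 2 * 0"
    by (intro tendsto_intros LIMSEQ_inverse_real_of_nat)
  then show "(\<lambda>n. 2 / real (Suc n)) \<longlonglongrightarrow> 0" by (simp add: divide_inverse)
qed

lemma smooth_conv_mollifier: "integrable lebesgue v \<Longrightarrow> smooth (conv (mollifier n) v)"
  unfolding mollifier_def by (rule smooth_conv[OF smooth_cc_bump smooth_cc_bump_minus])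

lemma continuous_on_smooth: "smooth f \<Longrightarrow> continuous_on UNIV f"
proof -
  assume "smooth f"
  moreover have "[] \<in> words 0" by (simp add: words_def)
  ultimately have "fold partial [] f differentiable_on UNIV" unfolding smooth_def by blast
  then show ?thesis by (simp add: differentiable_imp_continuous_on)
qed

lemma smooth_measurable: "smooth f \<Longrightarrow> f \<in> borel_measurable lebesgue"
  by (intro measurable_completion) (simp add: borel_measurable_continuous_onI continuous_on_smooth)

lemma bump_shift_support:
  "t \<notin> {x - 1 / Suc n..x} \<Longrightarrow> bump n (x - t) = 0"
  "t \<notin> {y..y + 1 / Suc n} \<Longrightarrow> bump n (t - y) = 0"
proof -
  have pos: "0 < 1 / real (Suc n) / 2" by simp
  show "bump n (x - t) = 0" if "t \<notin> {x - 1 / Suc n..x}"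
  proof (rule bump_eq_0)
    show "x - t \<notin> {1 / Suc n / 2..1 / Suc n}"
      using that pos unfolding atLeastAtMost_iff by linarith
  qed
  show "bump n (t - y) = 0" if "t \<notin> {y..y + 1 / Suc n}"
  proof (rule bump_eq_0)
    show "t - y \<notin> {1 / Suc n / 2..1 / Suc n}"
      using that pos unfolding atLeastAtMost_iff by linarith
  qed
qed

lemma smooth_real_bump_shift:
  "smooth_real (\<lambda>t. bump n (x - t))" "smooth_real (\<lambda>t. bump n (t - y))"
  using smooth_real_affine[OF smooth_real_bump, of n "-1" x]
    smooth_real_affine[OF smooth_real_bump, of n 1 "-y"] by simp_all

lemma smooth_cc_bump_shift:
  "smooth_cc (\<lambda>t. bump n (x - t))" "smooth_cc (\<lambda>t. bump n (t - y))"
  unfolding smooth_cc_def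
  using smooth_real_bump_shift bump_shift_support(1)[of _ x n] bump_shift_support(2)[of _ y n] by blast+

lemma test_fun_bump:
  assumes "{x - 1 / Suc n..x} \<times> {y..y + 1 / Suc n} \<subseteq> \<Omega>"
  shows "test_fun \<Omega> (tensor (\<lambda>t. bump n (x - t)) (\<lambda>t. bump n (t - y)))"
  by (rule test_fun_tensor[OF smooth_real_bump_shift bump_shift_support assms])

section \<open>Uniqueness of weak derivatives\<close>

text \<open>Once \<open>1 / Suc n\<close> is smaller than the distance from \<open>z\<close> to the
  left and to the upper edge, the shifted kernel is a test function supported in the box. The other
  two edges impose no condition, since the kernel never looks in their direction.\<close>

lemma conv_mollifier_eq_0_inside:
  fixes a b c d :: real
  assumes h: "\<And>\<phi>. test_fun \<Omega> \<phi> \<Longrightarrow> (LINT z:\<Omega>|lebesgue. h z * \<phi> z) = 0"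
    and sub: "cbox (a, c) (b, d) \<subseteq> \<Omega>" and z: "z \<in> box (a, c) (b, d)"
  shows "\<forall>\<^sub>F n in sequentially. conv (mollifier n) (\<lambda>w. indicator (cbox (a, c) (b, d)) w * h w) z = 0"
proof -
  obtain x y where xy: "z = (x, y)" by fastforce
  have in_box: "a < x" "x < b" "c < y" "y < d"
    using z by (auto simp: xy mem_box Basis_plane)
  have lim: "(\<lambda>n. 1 / real (Suc n)) \<longlonglongrightarrow> 0"
    using LIMSEQ_inverse_real_of_nat by (simp add: divide_inverse)
  have "\<forall>\<^sub>F n in sequentially. 1 / real (Suc n) < x - a" "\<forall>\<^sub>F n in sequentially. 1 / real (Suc n) < d - y"
    using in_box by (simp_all only: order_tendstoD(2)[OF lim] diff_gt_0_iff_gt)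
  then show ?thesis
  proof eventually_elim
    case (elim n)
    let ?\<phi> = "tensor (\<lambda>t. bump n (x - t)) (\<lambda>t. bump n (t - y))"
    have subn: "{x - 1 / Suc n..x} \<times> {y..y + 1 / Suc n} \<subseteq> cbox (a, c) (b, d)"
      using elim in_box by (auto simp: mem_box Basis_plane)
    then have zero: "(LINT w:\<Omega>|lebesgue. h w * ?\<phi> w) = 0"
      using sub by (intro h test_fun_bump) blast
    have eq: "indicator (cbox (a, c) (b, d)) w * h w * mollifier n (z - w) = indicator \<Omega> w *\<^sub>R (h w * ?\<phi> w)" for w
    proof (cases "?\<phi> w = 0")
      case False
      have "test_fun (cbox (a, c) (b, d)) ?\<phi>"
        using subn by (rule test_fun_bump)
      then have "w \<in> cbox (a, c) (b, d)"
        using False closure_subset[of "{z. ?\<phi> z \<noteq> 0}"] unfolding test_fun_def by blast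
      then show ?thesis using sub by (auto simp: mollifier_shift xy)
    qed (simp add: mollifier_shift xy)
    show ?case
      using zero unfolding conv_def set_lebesgue_integral_def eq .
  qed
qed

text \<open>
  The mollifications of \<open>h\<close> converge to \<open>h\<close> in \<open>L\<^sup>1\<close> and are eventually \<open>0\<close> at each interior
  point, so Fatou's lemma gives \<open>h = 0\<close>.
\<close>

lemma weak_null_imp_AE_0_box:
  fixes a b c d :: real
  assumes loc: "locally_integrable \<Omega> h"
    and h: "\<And>\<phi>. test_fun \<Omega> \<phi> \<Longrightarrow> (LINT z:\<Omega>|lebesgue. h z * \<phi> z) = 0"
    and sub: "cbox (a, c) (b, d) \<subseteq> \<Omega>"
  shows "AE z in lebesgue. z \<in> box (a, c) (b, d) \<longrightarrow> h z = 0"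
proof -
  let ?v = "\<lambda>w. indicator (cbox (a, c) (b, d)) w * h w"
  let ?f = "\<lambda>n z. ennreal \<bar>conv (mollifier n) ?v z - ?v z\<bar>"
  have v: "integrable lebesgue ?v"
  proof -
    have "h absolutely_integrable_on cbox (a, c) (b, d)"
      using loc sub compact_cbox unfolding locally_integrable_def by blast
    then show ?thesis unfolding set_integrable_def real_scaleR_def .
  qed
  have mf: "?f n \<in> borel_measurable lebesgue" for n
    by (rule measurable_compose[OF _ measurable_ennreal], rule borel_measurable_abs, rule borel_measurable_diff,
      rule smooth_measurable[OF smooth_conv_mollifier[OF v]], rule borel_measurable_integrable[OF v])
  have "(\<integral>\<^sup>+z. liminf (\<lambda>n. ?f n z) \<partial>lebesgue) \<le> liminf (\<lambda>n. \<integral>\<^sup>+z. ?f n z \<partial>lebesgue)"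
    by (rule nn_integral_liminf[OF mf])
  also have "\<dots> = 0"
    by (rule lim_imp_Liminf[OF sequentially_bot conv_mollifier_tendsto_L1[OF v]])
  finally have "(\<integral>\<^sup>+z. liminf (\<lambda>n. ?f n z) \<partial>lebesgue) = 0" unfolding le_zero_eq .
  then have "AE z in lebesgue. liminf (\<lambda>n. ?f n z) = 0"
    unfolding nn_integral_0_iff_AE[OF borel_measurable_liminf[OF mf]] .
  then show ?thesis
  proof (rule AE_mp, intro AE_I2 impI)
    fix z assume lim0: "liminf (\<lambda>n. ?f n z) = 0" and z: "z \<in> box (a, c) (b, d)"
    have "\<forall>\<^sub>F n in sequentially. ?f n z = ennreal \<bar>h z\<bar>"
      using conv_mollifier_eq_0_inside[OF h sub z]
    proof (rule eventually_mono)
      fix n assume "conv (mollifier n) ?v z = 0"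
      moreover have "z \<in> cbox (a, c) (b, d)" using z box_subset_cbox by blast
      ultimately show "?f n z = ennreal \<bar>h z\<bar>" by (simp add: indicator_def)
    qed
    then have "(\<lambda>n. ?f n z) \<longlonglongrightarrow> ennreal \<bar>h z\<bar>"
      by (rule tendsto_eventually)
    from lim_imp_Liminf[OF sequentially_bot this] have "ennreal \<bar>h z\<bar> = 0"
      unfolding lim0 by (rule sym)
    then show "h z = 0" by (simp add: ennreal_eq_0_iff)
  qed
qed

text \<open>By the Lindelof property countably many boxes with closure in \<Omega> cover \<Omega>,
  so the exceptional null sets of the single boxes add up to a null set.\<close>

lemma weak_null_imp_AE_0:
  fixes h :: "real \<times> real \<Rightarrow> real"
  assumes "open \<Omega>" and loc: "locally_integrable \<Omega> h"
    and h: "\<And>\<phi>. test_fun \<Omega> \<phi> \<Longrightarrow> (LINT z:\<Omega>|lebesgue. h z * \<phi> z) = 0"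
  shows "AE z in lebesgue. z \<in> \<Omega> \<longrightarrow> h z = 0"
proof -
  let ?\<B> = "{box p q | p q. cbox p q \<subseteq> \<Omega>}"
  obtain \<C> where \<C>: "\<C> \<subseteq> ?\<B>" "countable \<C>" "\<Union>\<C> = \<Union>?\<B>"
    by (rule Lindelof[of ?\<B>]) (auto intro: open_box)
  have null: "AE z in lebesgue. z \<in> B \<longrightarrow> h z = 0" if B: "B \<in> ?\<B>" for B
  proof -
    obtain p q where "B = box p q" "cbox p q \<subseteq> \<Omega>" using B by blast
    then show ?thesis
      using weak_null_imp_AE_0_box[OF loc h, of "fst p" "snd p" "fst q" "snd q"] by simp
  qed
  have "AE z in lebesgue. \<forall>B\<in>\<C>. z \<in> B \<longrightarrow> h z = 0"
    unfolding AE_ball_countable[OF \<C>(2)] using \<C>(1) null by blast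
  moreover have "\<Omega> \<subseteq> \<Union>?\<B>"
  proof
    fix z assume "z \<in> \<Omega>"
    then obtain p q where "cbox p q \<subseteq> \<Omega>" "z \<in> box p q"
      using open_contains_cbox[OF \<open>open \<Omega>\<close>] by metis
    then show "z \<in> \<Union>?\<B>" by blast
  qed
  ultimately show ?thesis
    unfolding \<C>(3)[symmetric] by (elim eventually_mono) blast
qed

lemma set_integrable_mult_test_fun:
  fixes g :: "'a::euclidean_space \<Rightarrow> real"
  assumes loc: "locally_integrable \<Omega> g" and \<phi>: "test_fun \<Omega> \<phi>"
  shows "set_integrable lebesgue \<Omega> (\<lambda>z. g z * \<phi> z)"
proof -
  let ?S = "closure {z. \<phi> z \<noteq> 0}"
  have S: "smooth \<phi>" "compact ?S" "?S \<subseteq> \<Omega>" using \<phi> unfolding test_fun_def by blast+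
  have "compact (\<phi> ` ?S)"
    using continuous_on_subset[OF continuous_on_smooth[OF S(1)] subset_UNIV] S(2) by (rule compact_continuous_image)
  then obtain C where C: "\<forall>y\<in>\<phi> ` ?S. norm y \<le> C"
    using compact_imp_bounded bounded_iff by metis
  have bound: "\<bar>\<phi> z\<bar> \<le> \<bar>C\<bar>" for z
  proof (cases "\<phi> z = 0")
    case False
    then have "z \<in> ?S" using closure_subset[of "{z. \<phi> z \<noteq> 0}"] by blast
    from bspec[OF C imageI[OF this]] show ?thesis unfolding real_norm_def by linarith
  qed simp
  have "integrable lebesgue (\<lambda>z. indicator ?S z * g z)"
  proof -
    have "g absolutely_integrable_on ?S"
      using loc S(2,3) unfolding locally_integrable_def by blast
    then show ?thesis unfolding set_integrable_def real_scaleR_def .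
  qed
  from integrable_mult_bounded[OF this smooth_measurable[OF S(1)] bound]
  have "integrable lebesgue (\<lambda>z. indicator ?S z * g z * \<phi> z)" .
  also have "(\<lambda>z. indicator ?S z * g z * \<phi> z) = (\<lambda>z. indicator \<Omega> z *\<^sub>R (g z * \<phi> z))"
  proof
    fix z
    show "indicator ?S z * g z * \<phi> z = indicator \<Omega> z *\<^sub>R (g z * \<phi> z)"
    proof (cases "\<phi> z = 0")
      case False
      then have "z \<in> ?S" using closure_subset[of "{z. \<phi> z \<noteq> 0}"] by blast
      moreover from this have "z \<in> \<Omega>" using S(3) by blast
      ultimately show ?thesis by (simp add: indicator_def)
    qed simp
  qed
  finally show ?thesis unfolding set_integrable_def .
qed

lemma locally_integrable_diff:
  "locally_integrable \<Omega> g \<Longrightarrow> locally_integrable \<Omega> h \<Longrightarrow> locally_integrable \<Omega> (\<lambda>z. g z - h z)"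
  unfolding locally_integrable_def by (intro allI impI set_integral_diff(1)) simp_all

lemma has_weak_derivD:
  "has_weak_deriv \<Omega> bs u g \<Longrightarrow> test_fun \<Omega> \<phi> \<Longrightarrow>
    (LINT z:\<Omega>|lebesgue. u z * fold partial bs \<phi> z) = (-1) ^ length bs * (LINT z:\<Omega>|lebesgue. g z * \<phi> z)"
  unfolding has_weak_deriv_def by blast

lemma has_weak_deriv_unique:
  fixes u :: "real \<times> real \<Rightarrow> real"
  assumes "open \<Omega>" and g: "has_weak_deriv \<Omega> bs u g" and h: "has_weak_deriv \<Omega> bs u h"
  shows "AE z in lebesgue. z \<in> \<Omega> \<longrightarrow> g z = h z"
proof -
  have loc: "locally_integrable \<Omega> g" "locally_integrable \<Omega> h"
    using g h unfolding has_weak_deriv_def by blast+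
  have "AE z in lebesgue. z \<in> \<Omega> \<longrightarrow> g z - h z = 0"
  proof (rule weak_null_imp_AE_0[OF \<open>open \<Omega>\<close> locally_integrable_diff[OF loc]])
    fix \<phi> assume \<phi>: "test_fun \<Omega> \<phi>"
    have "(-1) ^ length bs * (LINT z:\<Omega>|lebesgue. g z * \<phi> z) = (-1) ^ length bs * (LINT z:\<Omega>|lebesgue. h z * \<phi> z)"
      using has_weak_derivD[OF g \<phi>] has_weak_derivD[OF h \<phi>] by simp
    then have "(LINT z:\<Omega>|lebesgue. g z * \<phi> z) = (LINT z:\<Omega>|lebesgue. h z * \<phi> z)" by simp
    moreover have "(LINT z:\<Omega>|lebesgue. g z * \<phi> z - h z * \<phi> z)
        = (LINT z:\<Omega>|lebesgue. g z * \<phi> z) - (LINT z:\<Omega>|lebesgue. h z * \<phi> z)"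
      using set_integrable_mult_test_fun[OF loc(1) \<phi>] set_integrable_mult_test_fun[OF loc(2) \<phi>]
      by (rule set_integral_diff)
    ultimately show "(LINT z:\<Omega>|lebesgue. (g z - h z) * \<phi> z) = 0"
      by (simp add: left_diff_distrib)
  qed
  then show ?thesis by simp
qed

section \<open>Weighted spaces on the strip\<close>

lemma epowr_measurable [measurable]: "(\<lambda>x. epowr x a) \<in> borel_measurable borel"
  unfolding epowr_def by measurable

lemma epowr_top: "0 < a \<Longrightarrow> epowr top a = top"
  by (simp add: epowr_def)

lemma muckenhoupt_AE_pos:
  assumes "\<nu> \<in> muckenhoupt p"
  shows "AE x in lebesgue. \<nu> x \<noteq> 0 \<and> \<nu> x \<noteq> top"
proof -
  have m: "\<nu> \<in> borel_measurable lebesgue" and e: "emeasure lebesgue (\<nu> -` {0, top}) = 0"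
    using assms by (auto simp: muckenhoupt_def)
  have "\<nu> -` {0, top} \<inter> space lebesgue \<in> sets lebesgue"
    using m by (rule measurable_sets) simp
  then have "\<nu> -` {0, top} \<in> null_sets lebesgue" using e by (simp add: null_sets_def)
  from AE_not_in[OF this] show ?thesis by (rule eventually_mono) simp
qed

text \<open>The whole interval \<open>{0<..<2 * pi}\<close> competes in the supremum, so the product
  of its two factors is finite. The first factor is nonzero because \<nu> is positive a.e., hence
  the second one cannot be infinite.\<close>

lemma muckenhoupt_dual_integrable:
  assumes p: "1 < p" and \<nu>: "\<nu> \<in> muckenhoupt p"
  shows "(\<integral>\<^sup>+x\<in>{0<..<2 * pi}. epowr (\<nu> x) (- 1 / (p - 1)) \<partial>lebesgue) < top"
proof -
  let ?I = "{0<..<2 * pi}"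
  let ?d = "average ?I (\<lambda>x. epowr (\<nu> x) (- 1 / (p - 1)))"
  have m: "\<nu> \<in> borel_measurable lebesgue" using \<nu> by (simp add: muckenhoupt_def)
  have em: "emeasure lebesgue ?I = ennreal (2 * pi)" by simp
  have "?I \<in> {I. is_interval I \<and> bounded I \<and> interior I \<noteq> {}}"
    using pi_gt_zero by (simp add: is_interval_oo not_le)
  then have "average ?I \<nu> * epowr ?d (p - 1)
      \<le> (SUP I\<in>{I. is_interval I \<and> bounded I \<and> interior I \<noteq> {}}.
        average I \<nu> * epowr (average I (\<lambda>x. epowr (\<nu> x) (- 1 / (p - 1)))) (p - 1))"
    by (rule SUP_upper)
  also have "\<dots> < top" using \<nu> by (simp add: muckenhoupt_def)
  finally have fin: "average ?I \<nu> * epowr ?d (p - 1) < top" .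
  have "(\<integral>\<^sup>+x\<in>?I. \<nu> x \<partial>lebesgue) \<noteq> 0"
  proof
    assume "(\<integral>\<^sup>+x\<in>?I. \<nu> x \<partial>lebesgue) = 0"
    moreover have "(\<lambda>x. \<nu> x * indicator ?I x) \<in> borel_measurable lebesgue"
      using m by (intro borel_measurable_times_ennreal borel_measurable_indicator) simp_all
    ultimately have "AE x in lebesgue. \<nu> x * indicator ?I x = 0"
      using nn_integral_0_iff_AE by blast
    then have "AE x in lebesgue. x \<notin> ?I"
      using muckenhoupt_AE_pos[OF \<nu>] by eventually_elim (auto simp: indicator_def)
    then have "emeasure lebesgue ?I = 0"
      by (subst (asm) AE_iff_measurable[where N = "?I"]) auto
    then show False using em pi_gt_zero by (simp add: ennreal_eq_0_iff not_le)
  qed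
  then have "average ?I \<nu> \<noteq> 0"
    unfolding average_def em by (simp add: ennreal_divide_eq_0_iff)
  then have "epowr ?d (p - 1) \<noteq> top"
    using fin by (auto simp: ennreal_mult_eq_top_iff)
  then have "?d \<noteq> top" using epowr_top[of "p - 1"] p by (metis diff_gt_0_iff_gt)
  then show ?thesis
    unfolding average_def em by (auto simp: ennreal_divide_eq_top_iff less_top)
qed

text \<open>
  A crude form of Young's inequality: one of the two summands alone dominates \<open>t / m\<close>, according
  to whether \<open>(t / m)\<^bsup>p-1\<^esup> n \<ge> 1\<close>.
\<close>

lemma powr_split_bound:
  fixes t m n p :: real
  assumes "0 \<le> t" "0 < m" "0 < n" "1 < p"
  shows "t \<le> m * (1 / (m powr p) * (t powr p * n) + n powr (- 1 / (p - 1)))"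
proof -
  let ?s = "t / m"
  have "?s \<le> ?s powr p * n + n powr (- 1 / (p - 1))"
  proof (cases "?s \<le> n powr (- 1 / (p - 1))")
    case True
    then show ?thesis using assms by (simp add: add_increasing)
  next
    case False
    have spos: "0 < ?s" using False powr_ge_zero[of n "- 1 / (p - 1)"] by linarith
    have "(n powr (- 1 / (p - 1))) powr (p - 1) \<le> ?s powr (p - 1)"
      using False assms by (intro powr_mono2) auto
    moreover have "(n powr (- 1 / (p - 1))) powr (p - 1) = 1 / n"
    proof -
      have "- 1 / (p - 1) * (p - 1) = - 1" using assms by simp
      then show ?thesis unfolding powr_powr using assms by (simp only: powr_minus_divide powr_one)
    qed
    ultimately have "1 / n \<le> ?s powr (p - 1)" by simp
    then have "1 \<le> ?s powr (p - 1) * n" using assms by (simp add: field_simps)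
    then have "?s * 1 \<le> ?s * (?s powr (p - 1) * n)" using spos by (intro mult_left_mono) auto
    also have "\<dots> = ?s powr p * n"
      unfolding mult.assoc[symmetric] powr_mult_base[OF less_imp_le[OF spos]] by simp
    finally show ?thesis by (simp add: add_increasing2)
  qed
  then have "m * ?s \<le> m * (?s powr p * n + n powr (- 1 / (p - 1)))"
    using assms by (intro mult_left_mono) auto
  then show ?thesis using assms by (simp add: powr_divide)
qed

lemma ennreal_split_bound:
  assumes "0 \<le> m" "0 \<le> a" "0 \<le> b" "0 \<le> n" "0 \<le> d"
  shows "ennreal (m * (a * (b * n) + d))
    = ennreal m * (ennreal a * (ennreal b * ennreal n) + ennreal d)"
  using assms by (simp add: ennreal_mult)

text \<open>This is Hoelder's inequality with a cruder constant. Splitting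
  \<open>\<bar>g x\<bar>\<close> with scale \<open>m\<close> above the norm \<open>N\<close> makes
  the weighted term contribute at most \<open>m\<close> and the dual weight \<open>m * C\<close>;
  then \<open>m\<close> decreases to \<open>N\<close>. Working with \<open>m > N\<close> keeps the
  scale positive even when \<open>N = 0\<close>.\<close>

lemma L1_le_Lp_norm_interval:
  assumes p: "1 < p" and \<nu>: "\<nu> \<in> muckenhoupt p" and [measurable]: "g \<in> borel_measurable lebesgue"
    and C: "(\<integral>\<^sup>+x\<in>{0<..<2 * pi}. epowr (\<nu> x) (- 1 / (p - 1)) \<partial>lebesgue) = ennreal C" "0 \<le> C"
  shows "(\<integral>\<^sup>+x\<in>{0<..<2 * pi}. ennreal \<bar>g x\<bar> \<partial>lebesgue) \<le> ennreal (1 + C) * Lp_norm_interval p \<nu> g"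
proof -
  let ?I = "{0<..<2 * pi}"
  have [measurable]: "\<nu> \<in> borel_measurable lebesgue" using \<nu> by (simp add: muckenhoupt_def)
  let ?A = "\<integral>\<^sup>+x\<in>?I. ennreal (\<bar>g x\<bar> powr p) * \<nu> x \<partial>lebesgue"
  show ?thesis
  proof (cases ?A)
    case top
    then have "Lp_norm_interval p \<nu> g = top"
      using p by (simp add: Lp_norm_interval_def epowr_def)
    then show ?thesis using C(2) by (simp add: ennreal_mult_top)
  next
    case (real a)
    define N where "N = a powr (1 / p)"
    have N: "0 \<le> N" "N powr p = a" using p real(1) by (auto simp: N_def powr_powr)
    have norm: "Lp_norm_interval p \<nu> g = ennreal N"
      using p real by (auto simp: Lp_norm_interval_def epowr_def N_def ennreal_eq_0_iff)
    have bound: "(\<integral>\<^sup>+x\<in>?I. ennreal \<bar>g x\<bar> \<partial>lebesgue) \<le> ennreal (m * (1 + C))" if m: "m > N" for m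
    proof -
      have mpos: "0 < m" using m N by linarith
      have "(\<integral>\<^sup>+x\<in>?I. ennreal \<bar>g x\<bar> \<partial>lebesgue)
        \<le> (\<integral>\<^sup>+x. ennreal m * (ennreal (1 / m powr p) * (ennreal (\<bar>g x\<bar> powr p) * \<nu> x * indicator ?I x)
              + epowr (\<nu> x) (- 1 / (p - 1)) * indicator ?I x) \<partial>lebesgue)"
      proof (rule nn_integral_mono_AE)
        show "AE x in lebesgue. ennreal \<bar>g x\<bar> * indicator ?I x
          \<le> ennreal m * (ennreal (1 / m powr p) * (ennreal (\<bar>g x\<bar> powr p) * \<nu> x * indicator ?I x)
              + epowr (\<nu> x) (- 1 / (p - 1)) * indicator ?I x)"
          using muckenhoupt_AE_pos[OF \<nu>]
        proof (rule eventually_mono)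
          fix x assume x: "\<nu> x \<noteq> 0 \<and> \<nu> x \<noteq> top"
          then obtain n where n: "\<nu> x = ennreal n" "n > 0"
            by (cases "\<nu> x") (auto simp: ennreal_eq_0_iff)
          have "epowr (\<nu> x) (- 1 / (p - 1)) = ennreal (n powr (- 1 / (p - 1)))"
            using n p by (simp add: epowr_def ennreal_eq_0_iff)
          moreover have "ennreal \<bar>g x\<bar> \<le> ennreal m * (ennreal (1 / m powr p) * (ennreal (\<bar>g x\<bar> powr p) * ennreal n)
              + ennreal (n powr (- 1 / (p - 1))))"
          proof -
            have "ennreal \<bar>g x\<bar> \<le> ennreal (m * (1 / m powr p * (\<bar>g x\<bar> powr p * n) + n powr (- 1 / (p - 1))))"
              by (rule ennreal_leI[OF powr_split_bound[OF abs_ge_zero mpos n(2) p]])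
            also have "\<dots> = ennreal m * (ennreal (1 / m powr p) * (ennreal (\<bar>g x\<bar> powr p) * ennreal n)
                + ennreal (n powr (- 1 / (p - 1))))"
              using mpos n(2) by (intro ennreal_split_bound) simp_all
            finally show ?thesis .
          qed
          ultimately show "ennreal \<bar>g x\<bar> * indicator ?I x
            \<le> ennreal m * (ennreal (1 / m powr p) * (ennreal (\<bar>g x\<bar> powr p) * \<nu> x * indicator ?I x)
              + epowr (\<nu> x) (- 1 / (p - 1)) * indicator ?I x)"
            using n(1) by (cases "x \<in> ?I") simp_all
        qed
      qed
      also have "\<dots> = ennreal m * (ennreal (1 / m powr p) * ennreal a + ennreal C)"
      proof -
        have [measurable]: "?I \<in> sets lebesgue" by simp
        have mA: "(\<lambda>x. ennreal (\<bar>g x\<bar> powr p) * \<nu> x * indicator ?I x) \<in> borel_measurable lebesgue"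
          by (intro borel_measurable_times_ennreal borel_measurable_indicator) measurable
        have mD: "(\<lambda>x. epowr (\<nu> x) (- 1 / (p - 1)) * indicator ?I x) \<in> borel_measurable lebesgue"
          by (intro borel_measurable_times_ennreal borel_measurable_indicator
              measurable_compose[OF _ epowr_measurable]) measurable
        have mkA: "(\<lambda>x. ennreal (1 / m powr p) * (ennreal (\<bar>g x\<bar> powr p) * \<nu> x * indicator ?I x)) \<in> borel_measurable lebesgue"
          by (rule borel_measurable_times_ennreal[OF borel_measurable_const mA])
        show ?thesis
          unfolding nn_integral_cmult[OF borel_measurable_add[OF mkA mD]] nn_integral_add[OF mkA mD]
            nn_integral_cmult[OF mA] real(2) C(1) ..
      qed
      also have "\<dots> \<le> ennreal m * (1 + ennreal C)"
      proof (intro mult_left_mono add_right_mono)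
        have "a \<le> m powr p" unfolding N(2)[symmetric] using m N p by (intro powr_mono2) auto
        then have "1 / m powr p * a \<le> 1" using mpos by (simp add: field_simps)
        then show "ennreal (1 / m powr p) * ennreal a \<le> 1"
          using real(1) ennreal_mult[of "1 / m powr p" a] ennreal_leI[of "1 / m powr p * a" 1] by simp
      qed simp
      also have "\<dots> = ennreal (m * (1 + C))"
        using mpos C(2) by (simp add: ennreal_mult ennreal_plus)
      finally show ?thesis .
    qed
    have "(\<integral>\<^sup>+x\<in>?I. ennreal \<bar>g x\<bar> \<partial>lebesgue) \<le> ennreal (N * (1 + C))"
    proof (rule ennreal_le_epsilon)
      \<comment> \<open>The scale \<open>m = N + e / (1 + C)\<close> is chosen so that
        \<open>m * (1 + C)\<close> exceeds the desired bound by exactly \<open>e\<close>.\<close>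
      fix e :: real assume e: "0 < e"
      have "(\<integral>\<^sup>+x\<in>?I. ennreal \<bar>g x\<bar> \<partial>lebesgue) \<le> ennreal ((N + e / (1 + C)) * (1 + C))"
        using e C(2) by (intro bound) simp
      also have "(N + e / (1 + C)) * (1 + C) = N * (1 + C) + e"
        using C(2) by (simp add: distrib_right)
      also have "ennreal \<dots> = ennreal (N * (1 + C)) + ennreal e"
        using N(1) C(2) e by (intro ennreal_plus) auto
      finally show "(\<integral>\<^sup>+x\<in>?I. ennreal \<bar>g x\<bar> \<partial>lebesgue) \<le> ennreal (N * (1 + C)) + ennreal e" .
    qed
    then show ?thesis
    proof -
      have "ennreal ((1 + C) * N) = ennreal (1 + C) * ennreal N"
        by (rule ennreal_mult) (use N(1) C(2) in simp_all)
      then show ?thesis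
        using \<open>(\<integral>\<^sup>+x\<in>?I. ennreal \<bar>g x\<bar> \<partial>lebesgue) \<le> ennreal (N * (1 + C))\<close>
        unfolding norm mult.commute[of N] by (simp only:)
    qed
  qed
qed

section \<open>From the weighted norm to integrability on the strip\<close>

lemma locally_integrable_imp_measurable:
  fixes g :: "'a::euclidean_space \<Rightarrow> real"
  assumes "open \<Omega>" and loc: "locally_integrable \<Omega> g"
  shows "(\<lambda>z. indicator \<Omega> z * g z) \<in> borel_measurable lebesgue"
proof -
  obtain C :: "nat \<Rightarrow> 'a set" where C: "\<And>n. compact (C n)" "\<And>n. C n \<subseteq> \<Omega>"
    "\<And>K. compact K \<Longrightarrow> K \<subseteq> \<Omega> \<Longrightarrow> \<exists>N. \<forall>n\<ge>N. K \<subseteq> C n"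
    using open_Union_compact_subsets[OF \<open>open \<Omega>\<close>] by metis
  show ?thesis
  proof (rule borel_measurable_LIMSEQ_real)
    show "(\<lambda>z. indicator (C n) z * g z) \<in> borel_measurable lebesgue" for n
    proof -
      have "g absolutely_integrable_on C n"
        using loc C unfolding locally_integrable_def by blast
      then show ?thesis unfolding set_integrable_def real_scaleR_def by (rule borel_measurable_integrable)
    qed
    show "(\<lambda>n. indicator (C n) z * g z) \<longlonglongrightarrow> indicator \<Omega> z * g z" for z
    proof (cases "z \<in> \<Omega>")
      case True
      then obtain N where "\<forall>n\<ge>N. {z} \<subseteq> C n" using C(3)[of "{z}"] compact_sing by blast
      then have "\<forall>\<^sub>F n in sequentially. indicator (C n) z * g z = indicator \<Omega> z * g z"
        unfolding eventually_sequentially using True by (intro exI[of _ N]) (simp add: indicator_def)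
      then show ?thesis by (rule tendsto_eventually)
    next
      case False
      then have "z \<notin> C n" for n using C(2)[of n] by blast
      then show ?thesis using False by simp
    qed
  qed
qed

text \<open>The norm on the strip integrates in \<open>x\<close> first, so the horizontal slices are
  the relevant ones. The product rule for null sets yields the vertical ones; exchanging the order
  needs a measurable exceptional set, for which the null set \<open>N\<close> is introduced.\<close>

lemma AE_lebesgue_slices:
  fixes P :: "real \<times> real \<Rightarrow> bool"
  assumes "AE z in lborel. P z"
  shows "AE y in lborel. AE x in lborel. P (x, y)"
proof -
  obtain N where N: "\<And>z. z \<in> space lborel - N \<Longrightarrow> P z" "N \<in> null_sets lborel"
    by (rule AE_E3[OF assms]) (rule that)
  have meas: "N \<in> sets (lborel \<Otimes>\<^sub>M lborel)" using N(2) unfolding lborel_prod by (rule null_setsD2)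
  have "AE z in lborel \<Otimes>\<^sub>M lborel. z \<notin> N"
    unfolding lborel_prod by (rule AE_not_in[OF N(2)])
  then have "AE x in lborel. AE y in lborel. (x, y) \<notin> N"
    by (rule lborel_pair.AE_pair)
  then have "AE y in lborel. AE x in lborel. (x, y) \<notin> N"
  proof (subst (asm) lborel_pair.AE_commute)
    have "{z \<in> space (lborel \<Otimes>\<^sub>M lborel). (fst z, snd z) \<notin> N} = space (lborel \<Otimes>\<^sub>M lborel) - N"
      by auto
    then show "{z \<in> space (lborel \<Otimes>\<^sub>M lborel). (fst z, snd z) \<notin> N} \<in> sets (lborel \<Otimes>\<^sub>M lborel)"
      using sets.compl_sets[OF meas] by (simp only:)
  qed
  then show ?thesis
    by (rule eventually_mono) (erule eventually_mono, rule N(1), simp)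
qed

lemma open_strip: "open strip"
  unfolding strip_def by (intro open_Times) auto

text \<open>The mixed norm is an iterated integral with outer exponent 1. The estimate on the
  interval therefore applies on almost every horizontal line and can be integrated in
  \<open>y\<close>; Tonelli's theorem turns the result into a bound on the strip.\<close>

lemma Lp_norm_strip_imp_set_integrable:
  assumes p: "1 < p" and \<nu>: "\<nu> \<in> muckenhoupt p"
    and loc: "locally_integrable strip g" and fin: "Lp_norm_strip p \<nu> g < top"
  shows "set_integrable lebesgue strip g"
proof -
  let ?I = "{0<..<2 * pi}"
  let ?v = "\<lambda>z. indicator strip z * g z"
  have mv: "?v \<in> borel_measurable lebesgue"
    by (rule locally_integrable_imp_measurable[OF open_strip loc])
  then obtain v where v: "v \<in> borel_measurable lborel" "AE z in lborel. ?v z = v z"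
    using completion_ex_borel_measurable_real by blast
  have [measurable]: "v \<in> borel_measurable borel" using v(1) by simp
  obtain C where C: "(\<integral>\<^sup>+x\<in>?I. epowr (\<nu> x) (- 1 / (p - 1)) \<partial>lebesgue) = ennreal C" "0 \<le> C"
    using muckenhoupt_dual_integrable[OF p \<nu>] by (metis ennreal_cases less_irrefl)
  let ?F = "\<lambda>y. \<integral>\<^sup>+x. ennreal \<bar>v (x, y)\<bar> \<partial>lborel"
  have slice: "AE y in lborel. ?F y \<le> ennreal (1 + C) * (Lp_norm_interval p \<nu> (\<lambda>x. g (x, y)) * indicator {0<..} y)"
    using AE_lebesgue_slices[OF v(2)]
  proof (rule eventually_mono)
    fix y assume y: "AE x in lborel. ?v (x, y) = v (x, y)"
    then have y': "AE x in lebesgue. ?v (x, y) = v (x, y)" by (rule AE_completion)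
    show "?F y \<le> ennreal (1 + C) * (Lp_norm_interval p \<nu> (\<lambda>x. g (x, y)) * indicator {0<..} y)"
    proof (cases "y > 0")
      case True
      have "?F y = (\<integral>\<^sup>+x. ennreal \<bar>v (x, y)\<bar> \<partial>lebesgue)"
        by (rule nn_integral_completion[symmetric])
      also have "\<dots> = (\<integral>\<^sup>+x\<in>?I. ennreal \<bar>v (x, y)\<bar> \<partial>lebesgue)"
        using y' by (intro nn_integral_cong_AE) (auto elim!: eventually_mono simp: indicator_def strip_def split: if_splits)
      also have "\<dots> \<le> ennreal (1 + C) * Lp_norm_interval p \<nu> (\<lambda>x. v (x, y))"
        by (rule L1_le_Lp_norm_interval[OF p \<nu> _ C]) (rule measurable_completion, simp)
      also have "Lp_norm_interval p \<nu> (\<lambda>x. v (x, y)) = Lp_norm_interval p \<nu> (\<lambda>x. g (x, y))"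
      proof -
        have "(\<integral>\<^sup>+x\<in>?I. ennreal (\<bar>v (x, y)\<bar> powr p) * \<nu> x \<partial>lebesgue)
            = (\<integral>\<^sup>+x\<in>?I. ennreal (\<bar>g (x, y)\<bar> powr p) * \<nu> x \<partial>lebesgue)"
          using y' True by (intro nn_integral_cong_AE) (auto elim!: eventually_mono simp: indicator_def strip_def split: if_splits)
        then show ?thesis unfolding Lp_norm_interval_def by (simp only:)
      qed
      finally show ?thesis using True by simp
    next
      case False
      have "?F y = (\<integral>\<^sup>+x. 0 \<partial>(lborel :: real measure))"
        using y False by (intro nn_integral_cong_AE) (auto elim!: eventually_mono simp: indicator_def strip_def)
      then show ?thesis by simp
    qed
  qed
  have "(\<integral>\<^sup>+z. ennreal (norm (?v z)) \<partial>lebesgue) = (\<integral>\<^sup>+z. ennreal \<bar>v z\<bar> \<partial>lborel)"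
    unfolding nn_integral_completion using v(2)
    by (intro nn_integral_cong_AE) (auto elim!: eventually_mono)
  also have "\<dots> = (\<integral>\<^sup>+z. ennreal \<bar>v z\<bar> \<partial>(lborel \<Otimes>\<^sub>M lborel))" by (simp add: lborel_prod)
  also have "\<dots> = (\<integral>\<^sup>+y. ?F y \<partial>lborel)"
    by (rule lborel_pair.nn_integral_snd[symmetric, where f = "\<lambda>z. ennreal \<bar>v z\<bar>"]) (simp add: lborel_prod)
  also have "\<dots> < top"
  proof -
    have mF: "?F \<in> borel_measurable lborel" by simp
    have k: "ennreal (1 / (1 + C)) * ennreal (1 + C) = 1"
    proof -
      have "ennreal (1 / (1 + C) * (1 + C)) = ennreal (1 / (1 + C)) * ennreal (1 + C)"
        by (rule ennreal_mult) (use C(2) in simp_all)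
      moreover have "1 / (1 + C) * (1 + C) = 1" using C(2) by simp
      ultimately show ?thesis by simp
    qed
    \<comment> \<open>The slice norm of \<open>g\<close> has not been shown to be measurable in
      \<open>y\<close>, so a constant cannot simply be pulled out of its integral. Dividing by
      \<open>1 + C\<close> on the side of the measurable \<open>?F\<close> avoids this.\<close>
    have "ennreal (1 / (1 + C)) * (\<integral>\<^sup>+y. ?F y \<partial>lborel) = (\<integral>\<^sup>+y. ennreal (1 / (1 + C)) * ?F y \<partial>lborel)"
      using mF by (rule nn_integral_cmult[symmetric])
    also have "\<dots> \<le> (\<integral>\<^sup>+y. Lp_norm_interval p \<nu> (\<lambda>x. g (x, y)) * indicator {0<..} y \<partial>lborel)"
    proof (rule nn_integral_mono_AE)
      show "AE y in lborel. ennreal (1 / (1 + C)) * ?F y \<le> Lp_norm_interval p \<nu> (\<lambda>x. g (x, y)) * indicator {0<..} y"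
        using slice
      proof (rule eventually_mono)
        fix y assume "?F y \<le> ennreal (1 + C) * (Lp_norm_interval p \<nu> (\<lambda>x. g (x, y)) * indicator {0<..} y)"
        then have "ennreal (1 / (1 + C)) * ?F y
            \<le> ennreal (1 / (1 + C)) * (ennreal (1 + C) * (Lp_norm_interval p \<nu> (\<lambda>x. g (x, y)) * indicator {0<..} y))"
          by (rule mult_left_mono) simp
        then show "ennreal (1 / (1 + C)) * ?F y \<le> Lp_norm_interval p \<nu> (\<lambda>x. g (x, y)) * indicator {0<..} y"
          unfolding mult.assoc[symmetric] k by simp
      qed
    qed
    also have "\<dots> = Lp_norm_strip p \<nu> g"
      unfolding Lp_norm_strip_def nn_integral_completion ..
    finally have "ennreal (1 / (1 + C)) * (\<integral>\<^sup>+y. ?F y \<partial>lborel) < top" using fin by (rule order.strict_trans1)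
    moreover have "ennreal (1 / (1 + C)) \<noteq> 0" using C(2) by (simp add: ennreal_eq_0_iff)
    ultimately show ?thesis
      by (auto simp: ennreal_mult_eq_top_iff less_top[symmetric] ennreal_mult_less_top)
  qed
  finally have "integrable lebesgue ?v"
    using mv by (intro integrableI_bounded) simp_all
  then show ?thesis unfolding set_integrable_def by simp
qed

text \<open>Membership in the space bounds the norm of some weak derivative, whereas
  \<open>weak_deriv\<close> is an arbitrary choice. The two agree a.e. on the strip, and
  integrability carries over.\<close>

lemma W_strip_weak_deriv:
  assumes p: "1 < p" and \<nu>: "\<nu> \<in> muckenhoupt p" and u: "u \<in> W_strip m p \<nu>" and bs: "bs \<in> words m"
  shows "has_weak_deriv strip bs u (weak_deriv strip bs u)"
    and "set_integrable lebesgue strip (weak_deriv strip bs u)"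
proof -
  obtain g where g: "has_weak_deriv strip bs u g" "Lp_norm_strip p \<nu> g < top"
    using u bs unfolding W_strip_def sobolev_def by blast
  show wd: "has_weak_deriv strip bs u (weak_deriv strip bs u)"
    unfolding weak_deriv_def by (rule someI[where P = "has_weak_deriv strip bs u", OF g(1)])
  have loc: "locally_integrable strip g" "locally_integrable strip (weak_deriv strip bs u)"
    using g(1) wd unfolding has_weak_deriv_def by blast+
  have int: "integrable lebesgue (\<lambda>z. indicator strip z * g z)"
    using Lp_norm_strip_imp_set_integrable[OF p \<nu> loc(1) g(2)] by (simp add: set_integrable_def)
  have "AE z in lebesgue. indicator strip z * g z = indicator strip z * weak_deriv strip bs u z"
    using has_weak_deriv_unique[OF open_strip g(1) wd] by (rule eventually_mono) (auto simp: indicator_def)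
  then have "integrable lebesgue (\<lambda>z. indicator strip z * weak_deriv strip bs u z)"
    using int locally_integrable_imp_measurable[OF open_strip loc(1)]
      locally_integrable_imp_measurable[OF open_strip loc(2)]
    by (subst (asm) integrable_cong_AE)
  then show "set_integrable lebesgue strip (weak_deriv strip bs u)"
    by (simp add: set_integrable_def)
qed

section \<open>Weak derivatives up to the side of the strip\<close>

lemma partial_eq_0_outside:
  assumes "z \<notin> closure {w. \<phi> w \<noteq> 0}"
  shows "partial b \<phi> z = 0"
proof -
  let ?O = "(\<lambda>t. z + t *\<^sub>R b) -` (- closure {w. \<phi> w \<noteq> 0})"
  have "open ?O"
    by (intro open_vimage open_Compl closed_closure continuous_intros)
  moreover have "(0::real) \<in> ?O" using assms by simp
  moreover have "\<phi> (z + t *\<^sub>R b) = 0" if "t \<in> ?O" for t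
    using that closure_subset[of "{w. \<phi> w \<noteq> 0}"] by blast
  ultimately have "\<forall>\<^sub>F t in nhds 0. \<phi> (z + t *\<^sub>R b) = 0"
    unfolding eventually_nhds by blast
  then have "deriv (\<lambda>t. \<phi> (z + t *\<^sub>R b)) 0 = deriv (\<lambda>_. 0) (0::real)"
    by (rule deriv_cong_ev) simp
  then show ?thesis unfolding partial_def by simp
qed

lemma test_fun_partial:
  fixes \<phi> :: "'a::euclidean_space \<Rightarrow> real"
  assumes "test_fun \<Omega> \<phi>" and b: "b \<in> Basis"
  shows "test_fun \<Omega> (partial b \<phi>)"
proof -
  let ?S = "closure {z. \<phi> z \<noteq> 0}"
  have \<phi>: "smooth \<phi>" "compact ?S" "?S \<subseteq> \<Omega>"
    using assms(1) unfolding test_fun_def by blast+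
  have "smooth (partial b \<phi>)"
    unfolding smooth_def
  proof (intro allI ballI)
    fix m and bs :: "'a list" assume "bs \<in> words m"
    then have "b # bs \<in> words (Suc m)" using b by (simp add: words_def)
    then have "fold partial (b # bs) \<phi> differentiable_on UNIV"
      using \<phi>(1) unfolding smooth_def by blast
    then show "fold partial bs (partial b \<phi>) differentiable_on UNIV" by simp
  qed
  moreover have "{z. partial b \<phi> z \<noteq> 0} \<subseteq> ?S"
    using partial_eq_0_outside[of _ \<phi> b] by blast
  then have sub: "closure {z. partial b \<phi> z \<noteq> 0} \<subseteq> ?S"
    by (rule closure_minimal) simp
  moreover have "compact (closure {z. partial b \<phi> z \<noteq> 0})"
    using compact_Int_closed[OF \<phi>(2) closed_closure, of "{z. partial b \<phi> z \<noteq> 0}"] sub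
    by (simp add: inf.absorb2)
  ultimately show ?thesis
    using \<phi>(3) unfolding test_fun_def by blast
qed

text \<open>In the word \<open>[b, a]\<close> the derivative along \<open>b\<close> hits the test
  function first, so \<open>u\<close> is tested with \<open>partial a (partial b \<phi>)\<close>.
  Taking \<open>partial b \<phi>\<close> as test function in the first hypothesis moves the
  derivative along \<open>a\<close> onto \<open>u\<close>; the signs -1 and (-1)^2 combine to the
  one required.\<close>

lemma has_weak_deriv_compose:
  assumes g: "has_weak_deriv \<Omega> [a] u g" and h: "has_weak_deriv \<Omega> [b, a] u h" and b: "b \<in> Basis"
  shows "has_weak_deriv \<Omega> [b] g h"
  unfolding has_weak_deriv_def
proof (intro conjI allI impI)
  show "locally_integrable \<Omega> g" "locally_integrable \<Omega> h"
    using g h unfolding has_weak_deriv_def by blast+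
  fix \<phi> assume \<phi>: "test_fun \<Omega> \<phi>"
  show "(LINT z:\<Omega>|lebesgue. g z * fold partial [b] \<phi> z) = (-1) ^ length [b] * (LINT z:\<Omega>|lebesgue. h z * \<phi> z)"
    using has_weak_derivD[OF g test_fun_partial[OF \<phi> b]] has_weak_derivD[OF h \<phi>] by simp
qed

text \<open>Traces are formulated on the rectangles \<open>strip_upto \<xi>\<close>, while the
  derivatives at hand live on the whole strip.\<close>

lemma has_weak_deriv_subset:
  fixes u :: "'a::euclidean_space \<Rightarrow> real"
  assumes g: "has_weak_deriv \<Omega> [b] u g" and b: "b \<in> Basis" and sub: "\<Omega>' \<subseteq> \<Omega>"
  shows "has_weak_deriv \<Omega>' [b] u g"
  unfolding has_weak_deriv_def
proof (intro conjI allI impI)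
  show "locally_integrable \<Omega>' u" "locally_integrable \<Omega>' g"
    using g sub unfolding has_weak_deriv_def locally_integrable_def by blast+
  have restrict: "(LINT z:\<Omega>'|lebesgue. w z * \<psi> z) = (LINT z:\<Omega>|lebesgue. w z * \<psi> z)"
    if \<psi>: "test_fun \<Omega>' \<psi>" for w \<psi> :: "'a \<Rightarrow> real"
  proof -
    have "indicator \<Omega>' z *\<^sub>R (w z * \<psi> z) = indicator \<Omega> z *\<^sub>R (w z * \<psi> z)" for z
    proof (cases "\<psi> z = 0")
      case False
      then have "z \<in> \<Omega>'"
        using \<psi> closure_subset[of "{z. \<psi> z \<noteq> 0}"] unfolding test_fun_def by blast
      moreover from this have "z \<in> \<Omega>" using sub by blast
      ultimately show ?thesis by simp
    qed simp
    then show ?thesis unfolding set_lebesgue_integral_def by (simp only:)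
  qed
  fix \<phi> assume \<phi>: "test_fun \<Omega>' \<phi>"
  then have "test_fun \<Omega> \<phi>" using sub unfolding test_fun_def by blast
  from has_weak_derivD[OF g this]
  show "(LINT z:\<Omega>'|lebesgue. u z * fold partial [b] \<phi> z) = (-1) ^ length [b] * (LINT z:\<Omega>'|lebesgue. g z * \<phi> z)"
    using restrict[OF \<phi>, of g] restrict[OF test_fun_partial[OF \<phi> b], of u] by simp
qed

lemma set_integrable_mult_tensor:
  assumes v: "set_integrable lebesgue \<Omega> v" and "smooth_cc a" "smooth_cc b"
  shows "set_integrable lebesgue \<Omega> (\<lambda>z. v z * tensor a b z)"
proof -
  obtain C where C: "\<And>z. \<bar>tensor a b z\<bar> \<le> C" by (rule tensor_Taylor[OF assms(2,3)]) (rule that)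
  have m: "tensor a b \<in> borel_measurable lebesgue"
    using assms(2,3) unfolding smooth_cc_def
    by (intro measurable_completion) (simp add: tensor_measurable)
  from integrable_mult_bounded[OF v[unfolded set_integrable_def] m C]
  show ?thesis unfolding set_integrable_def by (simp add: mult.assoc)
qed

text \<open>Points of the strip have positive first coordinate, where the cutoffs tend to 1. Since
  they lie between 0 and 1, the integrand without cutoff dominates.\<close>

lemma cutoff_tensor_tendsto:
  assumes v: "set_integrable lebesgue strip v" and a: "smooth_cc a" and b: "smooth_cc b"
  shows "(\<lambda>k. LINT z:strip|lebesgue. v z * tensor (\<lambda>t. cutoff (Suc k) t * a t) b z)
    \<longlonglongrightarrow> (LINT z:strip|lebesgue. v z * tensor a b z)"
  unfolding set_lebesgue_integral_def
proof (rule integral_dominated_convergence)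
  note int = set_integrable_mult_tensor[OF v a b, unfolded set_integrable_def]
  have ka: "smooth_cc (\<lambda>t. cutoff (Suc k) t * a t)" for k
    using a smooth_real_mult[OF smooth_real_cutoff] unfolding smooth_cc_def by (metis mult_zero_right)
  show "(\<lambda>z. indicator strip z *\<^sub>R (v z * tensor a b z)) \<in> borel_measurable lebesgue"
    using int by (rule borel_measurable_integrable)
  show "(\<lambda>z. indicator strip z *\<^sub>R (v z * tensor (\<lambda>t. cutoff (Suc k) t * a t) b z)) \<in> borel_measurable lebesgue" for k
    using set_integrable_mult_tensor[OF v ka b] unfolding set_integrable_def by (rule borel_measurable_integrable)
  show "integrable lebesgue (\<lambda>z. norm (indicator strip z *\<^sub>R (v z * tensor a b z)))"
    using int by (rule integrable_norm)
  show "AE z in lebesgue. (\<lambda>k. indicator strip z *\<^sub>R (v z * tensor (\<lambda>t. cutoff (Suc k) t * a t) b z))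
      \<longlonglongrightarrow> indicator strip z *\<^sub>R (v z * tensor a b z)"
  proof (rule AE_I2)
    fix z
    show "(\<lambda>k. indicator strip z *\<^sub>R (v z * tensor (\<lambda>t. cutoff (Suc k) t * a t) b z))
      \<longlonglongrightarrow> indicator strip z *\<^sub>R (v z * tensor a b z)"
    proof (cases "z \<in> strip")
      case True
      then have "0 < fst z" unfolding strip_def by (simp add: mem_Times_iff)
      from LIMSEQ_Suc[OF cutoff_tendsto_1[OF this]]
      have "(\<lambda>k. indicator strip z *\<^sub>R (v z * ((cutoff (Suc k) (fst z) * a (fst z)) * b (snd z))))
        \<longlonglongrightarrow> indicator strip z *\<^sub>R (v z * ((1 * a (fst z)) * b (snd z)))"
        by (intro tendsto_intros)
      then show ?thesis unfolding tensor_def by simp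
    qed simp
  qed
  show "AE z in lebesgue. norm (indicator strip z *\<^sub>R (v z * tensor (\<lambda>t. cutoff (Suc k) t * a t) b z))
      \<le> norm (indicator strip z *\<^sub>R (v z * tensor a b z))" for k
  proof (rule AE_I2)
    fix z
    have "\<bar>cutoff (Suc k) (fst z)\<bar> * (\<bar>v z\<bar> * \<bar>a (fst z)\<bar> * \<bar>b (snd z)\<bar>) \<le> 1 * (\<bar>v z\<bar> * \<bar>a (fst z)\<bar> * \<bar>b (snd z)\<bar>)"
      using cutoff_bounds[of "Suc k" "fst z"] by (intro mult_right_mono) simp_all
    then have "\<bar>v z * (cutoff (Suc k) (fst z) * a (fst z) * b (snd z))\<bar> \<le> \<bar>v z * (a (fst z) * b (snd z))\<bar>"
      unfolding abs_mult by (simp add: mult_ac)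
    then show "norm (indicator strip z *\<^sub>R (v z * tensor (\<lambda>t. cutoff (Suc k) t * a t) b z))
      \<le> norm (indicator strip z *\<^sub>R (v z * tensor a b z))"
      unfolding tensor_def norm_scaleR unfolding real_norm_def by (rule mult_left_mono) simp
  qed
qed

text \<open>
  Derivatives along the side \<open>x = 0\<close> commute with a cutoff in \<open>x\<close>, so the test function
  need not vanish on that side.
\<close>

lemma weak_deriv_y_up_to_side:
  assumes wd: "has_weak_deriv strip [e\<^sub>y] v g"
    and v: "set_integrable lebesgue strip v" and g: "set_integrable lebesgue strip g"
    and a: "smooth_cc a" "\<And>t. r < t \<Longrightarrow> a t = 0" "r < 2 * pi"
    and b: "smooth_cc b" "\<And>t. t \<notin> {c..d} \<Longrightarrow> b t = 0" "0 < c"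
  shows "(LINT z:strip|lebesgue. v z * tensor a (deriv b) z) = - (LINT z:strip|lebesgue. g z * tensor a b z)"
proof (rule LIMSEQ_unique)
  show "(\<lambda>k. LINT z:strip|lebesgue. v z * tensor (\<lambda>t. cutoff (Suc k) t * a t) (deriv b) z)
    \<longlonglongrightarrow> (LINT z:strip|lebesgue. v z * tensor a (deriv b) z)"
    by (rule cutoff_tensor_tendsto[OF v a(1) smooth_cc_deriv[OF b(1)]])
  have sm: "smooth_real (\<lambda>t. cutoff (Suc k) t * a t)" "smooth_real b" for k
    using a(1) b(1) smooth_real_mult[OF smooth_real_cutoff] unfolding smooth_cc_def by blast+
  have "(LINT z:strip|lebesgue. v z * tensor (\<lambda>t. cutoff (Suc k) t * a t) (deriv b) z)
      = - (LINT z:strip|lebesgue. g z * tensor (\<lambda>t. cutoff (Suc k) t * a t) b z)" for k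
  proof -
    have "test_fun strip (tensor (\<lambda>t. cutoff (Suc k) t * a t) b)"
    proof (rule test_fun_tensor[OF sm])
      show "cutoff (Suc k) t * a t = 0" if "t \<notin> {1 / real (Suc k)..r}" for t
        using that a(2)[of t] cutoff_eq_0[of t "Suc k"] by (cases "t \<le> r") simp_all
      show "b t = 0" if "t \<notin> {c..d}" for t using that by (rule b(2))
      have pos: "0 < 1 / real (Suc k)" by simp
      have "{1 / real (Suc k)..r} \<subseteq> {0<..<2 * pi}"
        using order.strict_trans2[OF pos] order.strict_trans1[OF _ a(3)] by (intro subsetI) simp
      moreover have "{c..d} \<subseteq> {0<..}" using b(3) by (intro subsetI) simp
      ultimately show "{1 / real (Suc k)..r} \<times> {c..d} \<subseteq> strip"
        unfolding strip_def by (rule Sigma_mono)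
    qed
    from has_weak_derivD[OF wd this] show ?thesis
      by (simp add: partial_tensor(2)[OF sm])
  qed
  then show "(\<lambda>k. LINT z:strip|lebesgue. v z * tensor (\<lambda>t. cutoff (Suc k) t * a t) (deriv b) z)
    \<longlonglongrightarrow> - (LINT z:strip|lebesgue. g z * tensor a b z)"
    using tendsto_minus[OF cutoff_tensor_tendsto[OF g a(1) b(1)]] by simp
qed

lemma strip_test_fun_test_fun:
  assumes "test_fun strip \<phi>"
  shows "strip_test_fun \<phi>"
proof -
  let ?S = "closure {z. \<phi> z \<noteq> 0}"
  have \<phi>: "smooth \<phi>" "compact ?S" "?S \<subseteq> strip"
    using assms unfolding test_fun_def by blast+
  have zero: "\<phi> z = 0" if "z \<notin> ?S" for z
    using that closure_subset[of "{z. \<phi> z \<noteq> 0}"] by blast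
  obtain B where B: "\<forall>z\<in>?S. norm z \<le> B"
    using compact_imp_bounded[OF \<phi>(2)] bounded_iff by metis
  have far: "\<phi> (x, y) = 0" if "y \<ge> \<bar>B\<bar> + 1" for x y
  proof (rule zero, rule notI)
    assume "(x, y) \<in> ?S"
    then have "norm (x, y) \<le> B" using B by blast
    moreover have "norm y \<le> norm (x, y)" using norm_snd_le[of y x] by simp
    ultimately show False using that by simp
  qed
  show ?thesis
    unfolding strip_test_fun_def
  proof (intro conjI ballI allI impI)
    show "\<phi> (x, 0) = 0" for x
      using \<phi>(3) by (intro zero) (auto simp: strip_def)
    show "\<phi> (2 * pi, y) = 0" for y
      using \<phi>(3) by (intro zero) (auto simp: strip_def)
    show "\<exists>\<xi>>0. \<forall>x\<in>{0..2 * pi}. \<forall>y\<ge>\<xi>. \<phi> (x, y) = 0"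
      using far by (intro exI[of _ "\<bar>B\<bar> + 1"]) simp
  qed (rule \<phi>(1))
qed

text \<open>Nothing is demanded of \<open>a\<close> at 0. This freedom is what carries the condition
  on the side \<open>x = 0\<close>.\<close>

lemma strip_test_fun_tensor:
  assumes "smooth_real a" "smooth_real b" and a: "\<And>t. r < t \<Longrightarrow> a t = 0" "r < 2 * pi"
    and b: "\<And>t. t \<notin> {c..d} \<Longrightarrow> b t = 0" "0 < c"
  shows "strip_test_fun (tensor a b)"
  unfolding strip_test_fun_def
proof (intro conjI ballI allI impI)
  show "smooth (tensor a b)" by (rule smooth_tensor[OF assms(1,2)])
  show "tensor a b (x, 0) = 0" for x using b(1)[of 0] b(2) by (simp add: tensor_def)
  show "tensor a b (2 * pi, y) = 0" for y using a(1)[of "2 * pi"] a(2) by (simp add: tensor_def)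
  show "\<exists>\<xi>>0. \<forall>x\<in>{0..2 * pi}. \<forall>y\<ge>\<xi>. tensor a b (x, y) = 0"
  proof (intro exI[of _ "\<bar>d\<bar> + 1"] conjI ballI allI impI)
    fix x y :: real assume "\<bar>d\<bar> + 1 \<le> y"
    then have "b y = 0" by (intro b(1)) auto
    then show "tensor a b (x, y) = 0" by (simp add: tensor_def)
  qed simp
qed

lemma deriv_compose_affine:
  assumes "smooth_real f"
  shows "deriv (\<lambda>t. f (c * t + d)) t = c * deriv f (c * t + d)"
proof (rule DERIV_imp_deriv)
  have "((\<lambda>t. f (c * t + d)) has_real_derivative deriv f (c * t + d) * c) (at t)"
    using smooth_real_DERIV[OF assms] by (intro DERIV_chain2[where f = f]) (auto intro!: derivative_eq_intros)
  then show "((\<lambda>t. f (c * t + d)) has_real_derivative c * deriv f (c * t + d)) (at t)"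
    by (simp add: mult.commute)
qed

lemma deriv_bump_reflect:
  "deriv (\<lambda>t. bump n (- t)) t = - deriv (bump n) (- t)"
  "deriv (\<lambda>t. bump n (x - t)) t = - deriv (bump n) (x - t)"
  "deriv (\<lambda>t. bump n (t - y)) t = deriv (bump n) (t - y)"
  using deriv_compose_affine[OF smooth_real_bump, of n "-1" 0 t]
    deriv_compose_affine[OF smooth_real_bump, of n "-1" x t]
    deriv_compose_affine[OF smooth_real_bump, of n 1 "-y" t]
  by simp_all

lemma bump_eq_0_right: "x < t \<Longrightarrow> bump n (x - t) = 0"
  by (rule bump_shift_support(1)) simp

lemma conv_strip:
  assumes "\<And>w. K (z - w) = L w"
  shows "conv K (\<lambda>w. indicator strip w * v w) z = (LINT w:strip|lebesgue. v w * L w)"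
  unfolding conv_def set_lebesgue_integral_def assms by (simp add: mult.assoc)

text \<open>
  The test functions used in \<open>x\<close> do not vanish on the side \<open>x = 0\<close>, so \<open>dx\<close> says that
  extending \<open>v\<close> by zero across this side creates no jump.
\<close>

lemma zero_side_trace:
  assumes wx: "has_weak_deriv strip [e\<^sub>x] v g" and wy: "has_weak_deriv strip [e\<^sub>y] v h"
    and v: "set_integrable lebesgue strip v" and g: "set_integrable lebesgue strip g"
    and h: "set_integrable lebesgue strip h"
    and dx: "\<And>a b r c d. smooth_cc a \<Longrightarrow> (\<And>t. r < t \<Longrightarrow> a t = 0) \<Longrightarrow> r < 2 * pi \<Longrightarrow>
      smooth_cc b \<Longrightarrow> (\<And>t. t \<notin> {c..d} \<Longrightarrow> b t = 0) \<Longrightarrow> 0 < c \<Longrightarrow>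
      (LINT z:strip|lebesgue. v z * tensor (deriv a) b z) = - (LINT z:strip|lebesgue. g z * tensor a b z)"
  shows "has_side_trace 0 v (\<lambda>_. 0)"
  unfolding has_side_trace_def
proof (intro allI impI)
  fix \<xi> :: real
  let ?ext = "\<lambda>f w. indicator strip w * f w :: real"
  let ?U = "\<lambda>n. conv (mollifier n) (?ext v)"
  define D where "D b = (if b = e\<^sub>x then g else h)" for b
  have ev: "integrable lebesgue (?ext v)" "integrable lebesgue (?ext g)" "integrable lebesgue (?ext h)"
    using v g h unfolding set_integrable_def real_scaleR_def .
  have sub: "strip_upto \<xi> \<subseteq> strip" unfolding strip_upto_def strip_def by (intro Sigma_mono) auto
  \<comment> \<open>For \<open>z\<close> in the strip the shifted kernel vanishes beyond
    \<open>fst z\<close>, which is less than \<open>2 * pi\<close>, and below \<open>snd z\<close>,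
    which is positive, so both integrations by parts apply without further restriction on
    \<open>n\<close>. A derivative in \<open>z\<close> is minus the derivative in \<open>w\<close>,
    and this sign cancels the one from the integration by parts.\<close>
  have px: "partial e\<^sub>x (?U n) z = conv (mollifier n) (?ext g) z"
    and py: "partial e\<^sub>y (?U n) z = conv (mollifier n) (?ext h) z" if z: "z \<in> strip" for n z
  proof -
    let ?a = "\<lambda>t. bump n (fst z - t)" and ?b = "\<lambda>t. bump n (t - snd z)"
    have z': "fst z < 2 * pi" "0 < snd z" using z unfolding strip_def by (simp_all add: mem_Times_iff)
    have da: "tensor (deriv (bump n)) (\<lambda>t. bump n (- t)) (z - w) = - tensor (deriv ?a) ?b w" for w
      unfolding tensor_def deriv_bump_reflect by simp
    have db: "tensor (bump n) (deriv (\<lambda>t. bump n (- t))) (z - w) = - tensor ?a (deriv ?b) w" for w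
      unfolding tensor_def deriv_bump_reflect by simp
    have "partial e\<^sub>x (?U n) z = conv (tensor (deriv (bump n)) (\<lambda>t. bump n (- t))) (?ext v) z"
      unfolding mollifier_def partial_conv(1)[OF smooth_cc_bump smooth_cc_bump_minus ev(1)] ..
    also have "\<dots> = (LINT w:strip|lebesgue. v w * - tensor (deriv ?a) ?b w)"
      by (rule conv_strip) (rule da)
    also have "\<dots> = - (LINT w:strip|lebesgue. v w * tensor (deriv ?a) ?b w)"
      unfolding mult_minus_right set_lebesgue_integral_def scaleR_minus_right by (rule integral_minus)
    also have "\<dots> = (LINT w:strip|lebesgue. g w * tensor ?a ?b w)"
      using dx[where a = ?a and b = ?b and r = "fst z" and c = "snd z" and d = "snd z + 1 / Suc n",
          OF smooth_cc_bump_shift(1) bump_eq_0_right z'(1) smooth_cc_bump_shift(2)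
          bump_shift_support(2) z'(2)] by simp
    also have "\<dots> = conv (mollifier n) (?ext g) z"
      by (rule conv_strip[symmetric]) (rule mollifier_shift)
    finally show "partial e\<^sub>x (?U n) z = conv (mollifier n) (?ext g) z" .
    have "partial e\<^sub>y (?U n) z = conv (tensor (bump n) (deriv (\<lambda>t. bump n (- t)))) (?ext v) z"
      unfolding mollifier_def partial_conv(2)[OF smooth_cc_bump smooth_cc_bump_minus ev(1)] ..
    also have "\<dots> = (LINT w:strip|lebesgue. v w * - tensor ?a (deriv ?b) w)"
      by (rule conv_strip) (rule db)
    also have "\<dots> = - (LINT w:strip|lebesgue. v w * tensor ?a (deriv ?b) w)"
      unfolding mult_minus_right set_lebesgue_integral_def scaleR_minus_right by (rule integral_minus)
    also have "\<dots> = (LINT w:strip|lebesgue. h w * tensor ?a ?b w)"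
      using weak_deriv_y_up_to_side[where a = ?a and b = ?b and r = "fst z" and c = "snd z" and d = "snd z + 1 / Suc n",
          OF wy v h smooth_cc_bump_shift(1) bump_eq_0_right z'(1)
          smooth_cc_bump_shift(2) bump_shift_support(2) z'(2)] by simp
    also have "\<dots> = conv (mollifier n) (?ext h) z"
      by (rule conv_strip[symmetric]) (rule mollifier_shift)
    finally show "partial e\<^sub>y (?U n) z = conv (mollifier n) (?ext h) z" .
  qed
  have L1: "(\<lambda>n. \<integral>\<^sup>+z\<in>strip_upto \<xi>. ennreal \<bar>P n z - f z\<bar> \<partial>lebesgue) \<longlonglongrightarrow> 0"
    if P: "\<And>n z. z \<in> strip \<Longrightarrow> P n z = conv (mollifier n) (?ext f) z" and f: "integrable lebesgue (?ext f)"
    for P :: "nat \<Rightarrow> real \<times> real \<Rightarrow> real" and f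
  proof (rule tendsto_sandwich[OF _ _ tendsto_const conv_mollifier_tendsto_L1[OF f]])
    show "\<forall>\<^sub>F n in sequentially. (\<integral>\<^sup>+z\<in>strip_upto \<xi>. ennreal \<bar>P n z - f z\<bar> \<partial>lebesgue)
      \<le> (\<integral>\<^sup>+z. ennreal \<bar>conv (mollifier n) (?ext f) z - ?ext f z\<bar> \<partial>lebesgue)"
    proof (intro always_eventually allI nn_integral_mono)
      fix n z
      show "ennreal \<bar>P n z - f z\<bar> * indicator (strip_upto \<xi>) z
        \<le> ennreal \<bar>conv (mollifier n) (?ext f) z - ?ext f z\<bar>"
      proof (cases "z \<in> strip_upto \<xi>")
        case True
        then have "z \<in> strip" using sub by blast
        then show ?thesis using True by (simp add: P)
      qed simp
    qed
  qed simp
  \<comment> \<open>At a point of the side the kernel sees only \<open>fst w < 0\<close>, where the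
    extension is zero. The boundary values vanish exactly for every \<open>n\<close>, not merely in
    the limit.\<close>
  have trace: "?U n (0, t) = 0" for n t
  proof -
    have zero: "?ext v w * mollifier n ((0, t) - w) = 0" for w
    proof (cases "w \<in> strip")
      case True
      then have "0 < fst w" unfolding strip_def by (simp add: mem_Times_iff)
      then have "bump n (0 - fst w) = 0" by (rule bump_eq_0_right)
      then show ?thesis unfolding mollifier_shift tensor_def by simp
    qed simp
    show ?thesis unfolding conv_def zero by simp
  qed
  show "has_trace (strip_upto \<xi>) (\<lambda>y. (0, y)) {0<..<\<xi>} v (\<lambda>_. 0)"
    unfolding has_trace_def
  proof (intro conjI exI[of _ D] exI[of _ ?U] ballI allI)
    show "(\<lambda>_. 0) \<in> borel_measurable (lebesgue_on {0<..<\<xi>})" by simp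
    have De: "D e\<^sub>x = g" "D e\<^sub>y = h" by (simp_all add: D_def)
    fix b :: "real \<times> real" assume b: "b \<in> Basis"
    then consider "b = e\<^sub>x" | "b = e\<^sub>y" unfolding Basis_plane by blast
    then have "has_weak_deriv strip [b] v (D b) \<and>
      (\<lambda>n. \<integral>\<^sup>+z\<in>strip_upto \<xi>. ennreal \<bar>partial b (?U n) z - D b z\<bar> \<partial>lebesgue) \<longlonglongrightarrow> 0"
    proof cases
      case 1
      show ?thesis unfolding 1 De using wx L1[OF px ev(2)] by (intro conjI)
    next
      case 2
      show ?thesis unfolding 2 De using wy L1[OF py ev(3)] by (intro conjI)
    qed
    then show "has_weak_deriv (strip_upto \<xi>) [b] v (D b)"
      "(\<lambda>n. \<integral>\<^sup>+z\<in>strip_upto \<xi>. ennreal \<bar>partial b (?U n) z - D b z\<bar> \<partial>lebesgue) \<longlonglongrightarrow> 0"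
      using has_weak_deriv_subset[OF _ b sub] by blast+
  next
    show "smooth (?U n)" for n by (rule smooth_conv_mollifier[OF ev(1)])
    show "(\<lambda>n. \<integral>\<^sup>+z\<in>strip_upto \<xi>. ennreal \<bar>?U n z - v z\<bar> \<partial>lebesgue) \<longlonglongrightarrow> 0"
      by (rule L1[OF refl ev(1)])
    show "(\<lambda>n. \<integral>\<^sup>+t\<in>{0<..<\<xi>}. ennreal \<bar>?U n (0, t) - 0\<bar> \<partial>lebesgue) \<longlonglongrightarrow> 0"
      by (simp add: trace)
  qed
qed

section \<open>From the weak to the strong formulation\<close>

lemma locally_integrable_add:
  "locally_integrable \<Omega> g \<Longrightarrow> locally_integrable \<Omega> h \<Longrightarrow> locally_integrable \<Omega> (\<lambda>z. g z + h z)"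
  unfolding locally_integrable_def by (intro allI impI set_integral_add(1)) simp_all

theorem theorem3p4:
  fixes p :: real and \<nu> :: "real \<Rightarrow> ennreal"
    and f :: "real \<Rightarrow> real" and u :: "real \<times> real \<Rightarrow> real"
  assumes "1 < p"
    and "\<nu> \<in> muckenhoupt p"
    and "AE x in lebesgue_on {0<..<2 * pi}. \<nu> x = \<nu> (2 * pi - x)"
    and "f \<in> W_interval 1 p \<nu>"
    and "vanishes_at_endpoints f"
    and "weak_solution p \<nu> f u"
    and "u \<in> W_strip 2 p \<nu>"
  shows "strong_solution p \<nu> f u"
proof -
  let ?D = "\<lambda>bs. weak_deriv strip bs u"
  have Basis: "e\<^sub>x \<in> Basis" "e\<^sub>y \<in> Basis" by (simp_all add: Basis_plane)
  have words: "[e\<^sub>x] \<in> words 2" "[e\<^sub>y] \<in> words 2" "[e\<^sub>x, e\<^sub>x] \<in> words 2" "[e\<^sub>y, e\<^sub>x] \<in> words 2"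
    "[e\<^sub>y, e\<^sub>y] \<in> words 2"
    using Basis by (simp_all add: words_def)
  note wd = W_strip_weak_deriv(1)[OF assms(1,2,7)] and int = W_strip_weak_deriv(2)[OF assms(1,2,7)]
  \<comment> \<open>A trace of \<open>u_x\<close> refers to its gradient, so the second derivatives
    of \<open>u\<close> are reread as first derivatives of \<open>u_x\<close> and
    \<open>u_y\<close>; the mixed one is taken as the \<open>y\<close>-derivative of
    \<open>u_x\<close>.\<close>
  have wxx: "has_weak_deriv strip [e\<^sub>x] (?D [e\<^sub>x]) (?D [e\<^sub>x, e\<^sub>x])"
    by (rule has_weak_deriv_compose[OF wd[OF words(1)] wd[OF words(3)] Basis(1)])
  have wxy: "has_weak_deriv strip [e\<^sub>y] (?D [e\<^sub>x]) (?D [e\<^sub>y, e\<^sub>x])"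
    by (rule has_weak_deriv_compose[OF wd[OF words(1)] wd[OF words(4)] Basis(2)])
  have wyy: "has_weak_deriv strip [e\<^sub>y] (?D [e\<^sub>y]) (?D [e\<^sub>y, e\<^sub>y])"
    by (rule has_weak_deriv_compose[OF wd[OF words(2)] wd[OF words(5)] Basis(2)])
  have loc: "locally_integrable strip (?D bs)" if "bs \<in> words 2" for bs
    using wd[OF that] unfolding has_weak_deriv_def by blast
  have weak: "(LINT z:strip|lebesgue. ?D [e\<^sub>x] z * partial e\<^sub>x \<phi> z + ?D [e\<^sub>y] z * partial e\<^sub>y \<phi> z) = 0"
    if "strip_test_fun \<phi>" for \<phi>
    using assms(6) that unfolding weak_solution_def by blast
  have laplace: "AE z in lebesgue. z \<in> strip \<longrightarrow> ?D [e\<^sub>x, e\<^sub>x] z + ?D [e\<^sub>y, e\<^sub>y] z = 0"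
  proof (rule weak_null_imp_AE_0[OF open_strip locally_integrable_add[OF loc[OF words(3)] loc[OF words(5)]]])
    fix \<phi> assume \<phi>: "test_fun strip \<phi>"
    have "(LINT z:strip|lebesgue. (?D [e\<^sub>x, e\<^sub>x] z + ?D [e\<^sub>y, e\<^sub>y] z) * \<phi> z)
      = (LINT z:strip|lebesgue. ?D [e\<^sub>x, e\<^sub>x] z * \<phi> z) + (LINT z:strip|lebesgue. ?D [e\<^sub>y, e\<^sub>y] z * \<phi> z)"
      unfolding distrib_right
      by (rule set_integral_add(2)[OF set_integrable_mult_test_fun[OF loc[OF words(3)] \<phi>]
            set_integrable_mult_test_fun[OF loc[OF words(5)] \<phi>]])
    also have "\<dots> = - ((LINT z:strip|lebesgue. ?D [e\<^sub>x] z * partial e\<^sub>x \<phi> z)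
        + (LINT z:strip|lebesgue. ?D [e\<^sub>y] z * partial e\<^sub>y \<phi> z))"
      using has_weak_derivD[OF wxx \<phi>] has_weak_derivD[OF wyy \<phi>] by simp
    also have "(LINT z:strip|lebesgue. ?D [e\<^sub>x] z * partial e\<^sub>x \<phi> z) + (LINT z:strip|lebesgue. ?D [e\<^sub>y] z * partial e\<^sub>y \<phi> z)
      = (LINT z:strip|lebesgue. ?D [e\<^sub>x] z * partial e\<^sub>x \<phi> z + ?D [e\<^sub>y] z * partial e\<^sub>y \<phi> z)"
      by (rule set_integral_add(2)[symmetric,
            OF set_integrable_mult_test_fun[OF loc[OF words(1)] test_fun_partial[OF \<phi> Basis(1)]]
            set_integrable_mult_test_fun[OF loc[OF words(2)] test_fun_partial[OF \<phi> Basis(2)]]])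
    also have "\<dots> = 0" by (rule weak[OF strip_test_fun_test_fun[OF \<phi>]])
    finally show "(LINT z:strip|lebesgue. (?D [e\<^sub>x, e\<^sub>x] z + ?D [e\<^sub>y, e\<^sub>y] z) * \<phi> z) = 0" by simp
  qed
  have "has_side_trace 0 (?D [e\<^sub>x]) (\<lambda>_. 0)"
  proof (rule zero_side_trace[OF wxx wxy int[OF words(1)] int[OF words(3)] int[OF words(4)]])
    fix a b :: "real \<Rightarrow> real" and r c d :: real
    assume a: "smooth_cc a" "\<And>t. r < t \<Longrightarrow> a t = 0" "r < 2 * pi"
      and b: "smooth_cc b" "\<And>t. t \<notin> {c..d} \<Longrightarrow> b t = 0" "0 < c"
    have sm: "smooth_real a" "smooth_real b" using a(1) b(1) unfolding smooth_cc_def by blast+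
    \<comment> \<open>The chain is: the integral of u_x a' b equals minus that of u_y a b' by the
      weak formulation, then that of u_yy a b since only a \<open>y\<close>-derivative is moved, and
      finally minus that of u_xx a b by the Laplace equation. In effect the product rule in
      \<open>x\<close> holds up to the side without a boundary term.\<close>
    have "(LINT z:strip|lebesgue. ?D [e\<^sub>x] z * tensor (deriv a) b z)
        + (LINT z:strip|lebesgue. ?D [e\<^sub>y] z * tensor a (deriv b) z)
      = (LINT z:strip|lebesgue. ?D [e\<^sub>x] z * tensor (deriv a) b z + ?D [e\<^sub>y] z * tensor a (deriv b) z)"
      by (rule set_integral_add(2)[symmetric,
            OF set_integrable_mult_tensor[OF int[OF words(1)] smooth_cc_deriv[OF a(1)] b(1)]
            set_integrable_mult_tensor[OF int[OF words(2)] a(1) smooth_cc_deriv[OF b(1)]]])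
    also have "\<dots> = 0"
      using weak[OF strip_test_fun_tensor[OF sm a(2,3) b(2,3)]] unfolding partial_tensor[OF sm] .
    finally have "(LINT z:strip|lebesgue. ?D [e\<^sub>x] z * tensor (deriv a) b z)
      = - (LINT z:strip|lebesgue. ?D [e\<^sub>y] z * tensor a (deriv b) z)" by simp
    also have "\<dots> = (LINT z:strip|lebesgue. ?D [e\<^sub>y, e\<^sub>y] z * tensor a b z)"
      using weak_deriv_y_up_to_side[OF wyy int[OF words(2)] int[OF words(5)] a b] by simp
    also have "\<dots> = (LINT z:strip|lebesgue. - (?D [e\<^sub>x, e\<^sub>x] z * tensor a b z))"
      unfolding set_lebesgue_integral_def
    proof (rule integral_cong_AE)
      show "(\<lambda>z. indicator strip z *\<^sub>R (?D [e\<^sub>y, e\<^sub>y] z * tensor a b z)) \<in> borel_measurable lebesgue"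
        using set_integrable_mult_tensor[OF int[OF words(5)] a(1) b(1)]
        unfolding set_integrable_def by (rule borel_measurable_integrable)
      show "(\<lambda>z. indicator strip z *\<^sub>R - (?D [e\<^sub>x, e\<^sub>x] z * tensor a b z)) \<in> borel_measurable lebesgue"
        using set_integrable_mult_tensor[OF int[OF words(3)] a(1) b(1)]
        unfolding set_integrable_def scaleR_minus_right
        by (intro borel_measurable_uminus borel_measurable_integrable)
      show "AE z in lebesgue. indicator strip z *\<^sub>R (?D [e\<^sub>y, e\<^sub>y] z * tensor a b z)
        = indicator strip z *\<^sub>R - (?D [e\<^sub>x, e\<^sub>x] z * tensor a b z)"
        using laplace
      proof (rule eventually_mono)
        fix z assume z: "z \<in> strip \<longrightarrow> ?D [e\<^sub>x, e\<^sub>x] z + ?D [e\<^sub>y, e\<^sub>y] z = 0"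
        show "indicator strip z *\<^sub>R (?D [e\<^sub>y, e\<^sub>y] z * tensor a b z)
          = indicator strip z *\<^sub>R - (?D [e\<^sub>x, e\<^sub>x] z * tensor a b z)"
        proof (cases "z \<in> strip")
          case True
          then have "?D [e\<^sub>y, e\<^sub>y] z = - ?D [e\<^sub>x, e\<^sub>x] z" using z by simp
          then show ?thesis by simp
        qed simp
      qed
    qed
    also have "\<dots> = - (LINT z:strip|lebesgue. ?D [e\<^sub>x, e\<^sub>x] z * tensor a b z)"
      unfolding set_lebesgue_integral_def scaleR_minus_right by (rule integral_minus)
    finally show "(LINT z:strip|lebesgue. ?D [e\<^sub>x] z * tensor (deriv a) b z)
      = - (LINT z:strip|lebesgue. ?D [e\<^sub>x, e\<^sub>x] z * tensor a b z)" .
  qed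
  moreover have "AE z in lebesgue_on strip. ?D [e\<^sub>x, e\<^sub>x] z + ?D [e\<^sub>y, e\<^sub>y] z = 0"
    using laplace open_strip by (subst AE_restrict_space_iff) auto
  \<comment> \<open>The two boundary conditions on \<open>u\<close> itself are taken over from the
    weak formulation; the zero function witnesses the condition on \<open>u_x\<close>.\<close>
  ultimately show ?thesis
    using assms(6,7) AE_I2[of "lebesgue_on {0<..}" "\<lambda>_. (0::real) = 0"]
    unfolding strong_solution_def weak_solution_def by blast
qed

end
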